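(* Let $N\ge2$ and $p=p_c:=\frac{2N}{N+1}>1$. Let $u(x,t)\ge0$ be the semigroup solution of the fast $p$-Laplacian evolution equation $\partial_t u=\mathrm{div}(|\nabla u|^{p-2}\nabla u)$ in $\mathbb{R}^N\times(0,\infty)$ with initial data $u_0\in L^1(\mathbb{R}^N)$, $u_0\ge0$. Then for every $t>0$ the mass is conserved: $$\int_{\mathbb{R}^N}u(x,t)\,dx=\int_{\mathbb{R}^N}u_0(x)\,dx .$$
   Context: The semigroup solution is the mild solution $u\in C([0,\infty);L^1(\mathbb{R}^N))$ with $u(0)=u_0$ produced by the Crandall–Liggett theorem (limit of implicit time discretization) for the $m$-accretive operator $u\mapsto-\mathrm{div}(|\nabla u|^{p-2}\nabla u)$ in $L^1(\mathbb{R}^N)$. These solutions form a semigroup of $L^1$ contractions, and nonnegative data give nonnegative solutions. *)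

theory Defs
  imports "HOL-Analysis.Analysis"
begin

text \<open>
  Elements of \<open>L\<^sup>1\<close> are represented by \<^term>\<open>lborel\<close>-integrable functions, i.e. by Borel
  representatives; all notions below are insensitive to modification on null sets.
\<close>

definition L1_dist :: "('a::euclidean_space \<Rightarrow> real) \<Rightarrow> ('a \<Rightarrow> real) \<Rightarrow> real" where
  "L1_dist f g = (LINT x|lborel. \<bar>f x - g x\<bar>)"

definition ess_bounded :: "('a::euclidean_space \<Rightarrow> real) \<Rightarrow> bool" where
  "ess_bounded f \<longleftrightarrow> (\<exists>M. AE x in lborel. \<bar>f x\<bar> \<le> M)"

definition locally_integrable :: "('a::euclidean_space \<Rightarrow> 'b::euclidean_space) \<Rightarrow> bool" where
  "locally_integrable f \<longleftrightarrow> (\<forall>K. compact K \<longrightarrow> set_integrable lborel K f)"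


subsection \<open>Weak gradients\<close>

primrec C_k :: "nat \<Rightarrow> ('a::euclidean_space \<Rightarrow> real) \<Rightarrow> bool" where
  "C_k 0 f \<longleftrightarrow> continuous_on UNIV f"
| "C_k (Suc k) f \<longleftrightarrow> f differentiable_on UNIV
     \<and> (\<forall>i\<in>Basis. C_k k (\<lambda>x. frechet_derivative f (at x) i))"

definition test_function :: "('a::euclidean_space \<Rightarrow> real) \<Rightarrow> bool" where
  "test_function \<phi> \<longleftrightarrow> (\<forall>k. C_k k \<phi>) \<and> compact (closure {x. \<phi> x \<noteq> 0})"

definition grad :: "('a::euclidean_space \<Rightarrow> real) \<Rightarrow> 'a \<Rightarrow> 'a" where
  "grad \<phi> x = (\<Sum>i\<in>Basis. frechet_derivative \<phi> (at x) i *\<^sub>R i)"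

definition weak_gradient :: "('a::euclidean_space \<Rightarrow> real) \<Rightarrow> ('a \<Rightarrow> 'a) \<Rightarrow> bool" where
  "weak_gradient u G \<longleftrightarrow> locally_integrable u \<and> locally_integrable G
     \<and> (\<forall>\<phi>. test_function \<phi> \<longrightarrow>
          (LINT x|lborel. u x *\<^sub>R grad \<phi> x) = - (LINT x|lborel. \<phi> x *\<^sub>R G x))"


subsection \<open>The \<open>p\<close>-Laplacian as an operator in \<open>L\<^sup>1\<close>\<close>

text \<open>
  Operators in \<open>L\<^sup>1\<close> are represented by their graphs. The first graph consists of the pairs
  \<open>(u, v)\<close> with \<open>u \<in> L\<^sup>1 \<inter> L\<^sup>\<infinity>\<close>, \<open>\<nabla>u \<in> L\<^sup>p\<close>, \<open>v \<in> L\<^sup>1\<close> and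
  \<open>v = - div (\<bar>\<nabla>u\<bar>\<^sup>p\<^sup>-\<^sup>2 \<nabla>u)\<close> in the sense of distributions. Where \<open>G x = 0\<close>, the flux is \<open>0\<close>,
  as it should be also for \<open>p < 2\<close>.

  For \<open>1 < p\<close> this graph is accretive, and by minimization of
  \<open>\<integral> (\<lambda>/p) \<bar>\<nabla>u\<bar>\<^sup>p + \<bar>u - f\<bar>\<^sup>2/2\<close> the range of \<open>I + \<lambda>A\<close> contains the dense set \<open>L\<^sup>1 \<inter> L\<^sup>\<infinity>\<close>
  for each \<open>\<lambda> > 0\<close>. Hence its closure in \<open>L\<^sup>1 \<times> L\<^sup>1\<close> is the \<open>m\<close>-accretive realization. It is the
  only \<open>m\<close>-accretive operator in \<open>L\<^sup>1\<close> extending the first graph, because an \<open>m\<close>-accretive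
  operator has no proper accretive extension.
\<close>

definition neg_p_laplacian_bounded ::
    "real \<Rightarrow> (('a::euclidean_space \<Rightarrow> real) \<times> ('a \<Rightarrow> real)) set" where
  "neg_p_laplacian_bounded p =
     {(u, v). integrable lborel u \<and> ess_bounded u \<and> integrable lborel v
        \<and> (\<exists>G. weak_gradient u G \<and> G \<in> borel_measurable lborel
              \<and> integrable lborel (\<lambda>x. norm (G x) powr p)
              \<and> (\<forall>\<phi>. test_function \<phi> \<longrightarrow>
                   (LINT x|lborel. (norm (G x) powr (p - 2) *\<^sub>R G x) \<bullet> grad \<phi> x)
                     = (LINT x|lborel. v x * \<phi> x)))}"

definition neg_p_laplacian_L1 ::
    "real \<Rightarrow> (('a::euclidean_space \<Rightarrow> real) \<times> ('a \<Rightarrow> real)) set" where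
  "neg_p_laplacian_L1 p =
     {(u, v). integrable lborel u \<and> integrable lborel v
        \<and> (\<exists>U V. (\<forall>n::nat. (U n, V n) \<in> neg_p_laplacian_bounded p)
              \<and> (\<lambda>n. L1_dist (U n) u) \<longlonglongrightarrow> 0
              \<and> (\<lambda>n. L1_dist (V n) v) \<longlonglongrightarrow> 0)}"


subsection \<open>Mild solutions\<close>

text \<open>
  A mild solution of \<open>u' + A u = 0\<close>, \<open>u(0) = u\<^sub>0\<close>, is a function in \<open>C([0,\<infinity>); L\<^sup>1)\<close> that is, on
  bounded time intervals, the uniform limit of piecewise constant solutions of the implicit
  discretization \<open>(w\<^sub>k\<^sub>+\<^sub>1 - w\<^sub>k) / (\<tau>\<^sub>k\<^sub>+\<^sub>1 - \<tau>\<^sub>k) + A w\<^sub>k\<^sub>+\<^sub>1 \<ni> 0\<close>. For \<open>m\<close>-accretive \<open>A\<close> and \<open>u\<^sub>0\<close> in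
  the closure of the domain, the Crandall-Liggett theorem says that it exists, is unique up to
  null sets and is given by \<open>u(t) = lim (I + (t/n) A)\<^sup>-\<^sup>n u\<^sub>0\<close>.
\<close>

definition mild_solution ::
    "(('a::euclidean_space \<Rightarrow> real) \<times> ('a \<Rightarrow> real)) set \<Rightarrow> ('a \<Rightarrow> real)
       \<Rightarrow> (real \<Rightarrow> 'a \<Rightarrow> real) \<Rightarrow> bool" where
  "mild_solution A u0 u \<longleftrightarrow>
     (\<forall>t\<ge>0. integrable lborel (u t))
     \<and> (\<forall>t\<ge>0. ((\<lambda>s. L1_dist (u s) (u t)) \<longlongrightarrow> 0) (at t within {0..}))
     \<and> (AE x in lborel. u 0 x = u0 x)
     \<and> (\<forall>T>0. \<forall>\<epsilon>>0. \<exists>(n::nat) (\<tau>::nat \<Rightarrow> real) w.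
          \<tau> 0 = 0 \<and> T \<le> \<tau> n \<and> (\<forall>k<n. \<tau> k < \<tau> (Suc k) \<and> \<tau> (Suc k) - \<tau> k \<le> \<epsilon>)
          \<and> integrable lborel (w 0) \<and> L1_dist (w 0) u0 \<le> \<epsilon>
          \<and> (\<forall>k<n. (w (Suc k), \<lambda>x. (w k x - w (Suc k) x) / (\<tau> (Suc k) - \<tau> k)) \<in> A
                 \<and> (\<forall>t\<in>{\<tau> k<..\<tau> (Suc k)}. L1_dist (u t) (w (Suc k)) \<le> \<epsilon>)))"

end

theory Submission
  imports Defs
begin

text \<open>
  Mass can be lost only by escaping to infinity, and at the critical exponent an integrable function
  is just too small at infinity to carry a flux there. The fundamental solution of the
  \<open>p\<close>-Laplacian behaves like \<open>\<bar>x\<bar>\<^sup>-\<^sup>(\<^sup>N\<^sup>-\<^sup>p\<^sup>)\<^sup>/\<^sup>(\<^sup>p\<^sup>-\<^sup>1\<^sup>)\<close>, which for \<open>p = 2N/(N+1)\<close> is \<open>\<bar>x\<bar>\<^sup>-\<^sup>N\<close>, and this fails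
  to be integrable at infinity by a logarithm. So the claim is elliptic: if \<open>u\<close> and \<open>v\<close> are in \<open>L\<^sup>1\<close>,
  \<open>\<nabla>u \<in> L\<^sup>p\<close> and \<open>v = - div (\<bar>\<nabla>u\<bar>\<^sup>p\<^sup>-\<^sup>2 \<nabla>u)\<close>, then \<open>\<integral> v = 0\<close>. This extends to the closure of the
  operator in \<open>L\<^sup>1\<close>. Given this, each step of the implicit time
  discretization preserves the integral, and so does the limit in \<open>L\<^sup>1\<close>.

  For the elliptic claim, let \<open>b\<close> be a cutoff function with values in \<open>[0,1]\<close> and put \<open>\<eta> = b(1 - b)\<close>
  and \<open>\<phi> = 3b\<^sup>2 - 2b\<^sup>3\<close>. Then \<open>\<nabla>\<phi> = 6\<eta>\<nabla>b\<close>, so with \<open>I = \<integral> \<bar>\<nabla>u\<bar>\<^sup>p\<^sup>-\<^sup>1 \<eta>\<bar>\<nabla>b\<bar>\<close> the equation gives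
  \<open>\<bar>\<integral> v\<phi>\<bar> \<le> 6I\<close>. To bound \<open>I\<close>, the equation is tested a second time, with \<open>H(u/k) \<eta>\<^sup>2\<close>, where \<open>H\<close> is
  a bounded primitive of \<open>s \<mapsto> (1 + s\<^sup>2)\<^sup>-\<^sup>\<theta>\<^sup>/\<^sup>2\<close> and \<open>\<theta> = 1/(p-1) > 1\<close>. With \<open>h\<close> denoting the derivative of
  \<open>s \<mapsto> H(s/k)\<close> and \<open>\<bar>H\<bar> \<le> C\<close>, this bounds the weighted energy:
  \<open>E = \<integral> \<bar>\<nabla>u\<bar>\<^sup>p h(u) \<eta>\<^sup>2 \<le> C (\<integral> \<bar>v\<bar> + 2I)\<close>. Conversely the weighted Young inequality
  \<open>a\<^sup>p\<^sup>-\<^sup>1 c \<le> s a\<^sup>p + s\<^sup>1\<^sup>-\<^sup>p c\<^sup>p\<close> with \<open>s = \<gamma> h(u) \<eta>\<^sup>2\<close> bounds \<open>I\<close> by \<open>\<gamma> E\<close> plus a remainder. The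
  exponent \<open>\<theta>\<close> is chosen such that \<open>h(u)\<^sup>1\<^sup>-\<^sup>p \<le> k\<^sup>p\<^sup>-\<^sup>2 (\<bar>u\<bar> + k)\<close>, so that the remainder is linear in \<open>\<bar>u\<bar>\<close>
  and the \<open>L\<^sup>1\<close> norm of \<open>u\<close> controls it. For small \<open>\<gamma>\<close> the term \<open>\<gamma> E\<close> is absorbed, and
  \<open>\<bar>\<integral> v\<phi>\<bar> \<le> 12 (\<gamma> C \<integral> \<bar>v\<bar> + \<gamma>\<^sup>1\<^sup>-\<^sup>p k\<^sup>p\<^sup>-\<^sup>2 \<integral> (\<bar>u\<bar> + k) \<eta>\<^sup>2\<^sup>-\<^sup>p \<bar>\<nabla>b\<bar>\<^sup>p)\<close>; this is
  \<open>weak_equation_mass_estimate\<close>.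

  Now \<open>b\<close> is replaced by \<open>b(x/R)\<close> and \<open>k = \<delta>R\<^sup>-\<^sup>N\<close>. All powers of \<open>R\<close> cancel because \<open>N(2-p) = p\<close>,
  which is the equation that defines the critical exponent, and the remainder becomes
  \<open>\<gamma>\<^sup>1\<^sup>-\<^sup>p \<delta>\<^sup>p\<^sup>-\<^sup>2 (\<integral> \<bar>u\<bar> w(x/R) + \<delta> \<integral> w)\<close> with \<open>w = \<eta>\<^sup>2\<^sup>-\<^sup>p \<bar>\<nabla>b\<bar>\<^sup>p\<close>. Since \<open>b(0) = 1\<close>, the weight \<open>w\<close>
  vanishes at \<open>0\<close>, so dominated convergence removes the integral with \<open>u\<close> as \<open>R \<rightarrow> \<infinity>\<close>, while
  \<open>\<integral> v\<phi>(x/R) \<rightarrow> \<integral> v\<close>. With \<open>\<delta> = \<gamma>\<^sup>2\<close> what remains is of the order \<open>\<gamma> + \<gamma>\<^sup>p\<^sup>-\<^sup>1\<close>, and \<open>\<gamma> \<rightarrow> 0\<close>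
  finishes the proof (\<open>neg_p_laplacian_bounded_integral_eq_0\<close>).

  The remaining work is to justify the test function \<open>H(u/k) \<eta>\<^sup>2\<close>, which is not smooth. It is
  approximated by replacing \<open>u\<close> with mollifications \<open>u\<^sub>n = \<rho>\<^sub>n * u\<close>, whose gradients are \<open>\<rho>\<^sub>n * \<nabla>u\<close>. The
  limit rests on convergence of mollifications in \<open>L\<^sup>1\<close>: a subsequence converges almost everywhere,
  and \<open>\<bar>\<nabla>u\<bar>\<^sup>p\<^sup>-\<^sup>1 \<bar>\<nabla>u\<^sub>n\<bar> \<le> \<bar>\<nabla>u\<bar>\<^sup>p + \<rho>\<^sub>n * \<bar>\<nabla>u\<bar>\<^sup>p\<close>, where the right hand side converges in \<open>L\<^sup>1\<close>, so that a
  dominated convergence theorem with varying dominating functions applies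
  (\<open>weak_equation_composite_test\<close>).
\<close>


section \<open>Smooth functions and test functions\<close>

lemma has_derivative_frechet:
  assumes "f differentiable_on UNIV"
  shows "(f has_derivative frechet_derivative f (at x)) (at x)"
  using assms by (simp add: differentiable_on_def frechet_derivative_works)

lemma C_k_SucI:
  assumes D: "\<And>x. (f has_derivative D x) (at x)"
    and C: "\<And>i. i \<in> Basis \<Longrightarrow> C_k k (\<lambda>x. D x i)"
  shows "C_k (Suc k) f"
proof -
  have "frechet_derivative f (at x) = D x" for x
    using frechet_derivative_at[OF D] by simp
  then show ?thesis
    using C D by (auto simp: differentiable_on_def differentiable_def intro: has_derivative_at_withinI)
qed

lemma C_k_continuous_on: "C_k k f \<Longrightarrow> continuous_on UNIV f"
  by (cases k) (auto intro: differentiable_imp_continuous_on)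

lemma C_k_SucD: "C_k (Suc k) f \<Longrightarrow> C_k k f"
proof (induction k arbitrary: f)
  case 0
  then show ?case using C_k_continuous_on[of "Suc 0" f] by simp
next
  case (Suc k)
  then show ?case by auto
qed

lemma C_k_const: "C_k k (\<lambda>x. c)"
proof (induction k arbitrary: c)
  case (Suc k)
  show ?case by (rule C_k_SucI[where D="\<lambda>x h. 0"]) (auto simp: Suc)
qed simp

lemma C_k_inner: "C_k k (\<lambda>x. x \<bullet> a)"
proof (cases k)
  case (Suc k)
  show ?thesis unfolding Suc
    by (rule C_k_SucI[where D="\<lambda>x h. h \<bullet> a"])
      (auto simp: C_k_const intro!: derivative_eq_intros)
qed (auto intro!: continuous_intros)

lemma C_k_add: "C_k k f \<Longrightarrow> C_k k g \<Longrightarrow> C_k k (\<lambda>x. f x + g x)"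
proof (induction k arbitrary: f g)
  case (Suc k)
  show ?case
    by (rule C_k_SucI[where D="\<lambda>x h. frechet_derivative f (at x) h + frechet_derivative g (at x) h"])
      (use Suc in \<open>auto intro!: derivative_eq_intros has_derivative_frechet\<close>)
qed (auto intro!: continuous_intros)

lemma C_k_mult: "C_k k f \<Longrightarrow> C_k k g \<Longrightarrow> C_k k (\<lambda>x. f x * g x)"
proof (induction k arbitrary: f g)
  case (Suc k)
  have "C_k k f" "C_k k g" using Suc.prems C_k_SucD by blast+
  then show ?case
    by (intro C_k_SucI[where D="\<lambda>x h. f x * frechet_derivative g (at x) h + frechet_derivative f (at x) h * g x"])
      (use Suc in \<open>auto intro!: derivative_eq_intros has_derivative_frechet C_k_add\<close>)
qed (auto intro!: continuous_intros)

lemma C_k_cmult: "C_k k f \<Longrightarrow> C_k k (\<lambda>x. c * f x)"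
  by (intro C_k_mult C_k_const)

lemma C_k_diff: "C_k k f \<Longrightarrow> C_k k g \<Longrightarrow> C_k k (\<lambda>x. f x - g x)"
  using C_k_add[OF _ C_k_cmult[of k g "-1"]] by simp

lemma C_k_power: "C_k k f \<Longrightarrow> C_k k (\<lambda>x. f x ^ n)"
  by (induction n) (auto intro: C_k_const C_k_mult)

lemma C_k_sum: "(\<And>i. i \<in> I \<Longrightarrow> C_k k (f i)) \<Longrightarrow> C_k k (\<lambda>x. \<Sum>i\<in>I. f i x)"
  by (induction I rule: infinite_finite_induct) (auto intro: C_k_const C_k_add)

lemma C_k_norm_power2: "C_k k (\<lambda>x::'a::euclidean_space. (norm x)\<^sup>2)"
proof -
  have "(norm x)\<^sup>2 = (\<Sum>i\<in>Basis. (x \<bullet> i)\<^sup>2)" for x :: 'a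
    unfolding power2_norm_eq_inner by (subst euclidean_inner) (simp add: power2_eq_square)
  then show ?thesis by (simp add: C_k_sum C_k_power C_k_inner)
qed

text \<open>
  The derivatives of a smooth function of one real variable often form a family that is closed under
  differentiation up to products with smooth factors. For such a family, one induction on the order
  of differentiability, carried out for all members at once, proves that all compositions with a
  smooth \<open>q\<close> are smooth.
\<close>

lemma C_k_compose_family:
  fixes F :: "'b \<Rightarrow> real \<Rightarrow> real"
  assumes der: "\<And>m s. (F m has_real_derivative D m s) (at s)"
    and C: "\<And>m k. C_k k q \<Longrightarrow> (\<And>m. C_k k (\<lambda>x. F m (q x))) \<Longrightarrow> C_k k (\<lambda>x. D m (q x))"
    and q: "\<And>k. C_k k q"
  shows "C_k k (\<lambda>x. F m (q x))"
proof (induction k arbitrary: m)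
  case 0
  have "continuous_on UNIV (F m)"
    using der by (meson DERIV_isCont continuous_at_imp_continuous_on)
  moreover have "continuous_on UNIV q" using q[of 0] by simp
  ultimately show ?case
    by (auto intro: continuous_on_compose2)
next
  case (Suc k)
  have qd: "(q has_derivative frechet_derivative q (at x)) (at x)" for x
    using q[of "Suc k"] by (intro has_derivative_frechet) simp
  have "((\<lambda>x. F m (q x)) has_derivative (\<lambda>h. frechet_derivative q (at x) h * D m (q x))) (at x)" for x
    using has_derivative_compose[OF qd, of "F m" "(*) (D m (q x))"] der[of m "q x"]
    by (simp add: has_field_derivative_def mult.commute)
  moreover have "C_k k (\<lambda>x. frechet_derivative q (at x) i * D m (q x))" if "i \<in> Basis" for i
    using q[of "Suc k"] that by (intro C_k_mult C q Suc) auto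
  ultimately show ?case by (rule C_k_SucI)
qed

lemma smooth_powr_compose:
  fixes q :: "'a::euclidean_space \<Rightarrow> real"
  assumes "\<And>k. C_k k q"
  shows "C_k k (\<lambda>x. (1 + (q x)\<^sup>2) powr a)"
proof (rule C_k_compose_family[where F="\<lambda>a s. (1 + s\<^sup>2) powr a" and D="\<lambda>a s. (2 * a) * (s * (1 + s\<^sup>2) powr (a - 1))"])
  show "((\<lambda>s. (1 + s\<^sup>2) powr m) has_real_derivative 2 * m * (s * (1 + s\<^sup>2) powr (m - 1))) (at s)" for m s :: real
  proof -
    have "0 < 1 + s\<^sup>2" by (simp add: add_pos_nonneg)
    then show ?thesis
      by (auto intro!: derivative_eq_intros simp: powr_diff field_simps)
  qed
next
  show "C_k k (\<lambda>x. 2 * m * (q x * (1 + (q x)\<^sup>2) powr (m - 1)))"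
    if "C_k k q" "\<And>m. C_k k (\<lambda>x. (1 + (q x)\<^sup>2) powr m)" for m k
    by (rule C_k_cmult, rule C_k_mult) (fact that)+
qed (fact assms)

text \<open>
  The functions \<open>s\<^sup>-\<^sup>m exp (-1/s)\<close>, extended by \<open>0\<close>. The derivative of each is a combination
  of two others, so the family is suited to \<open>C_k_compose_family\<close>.
\<close>

definition exp_flat :: "nat \<Rightarrow> real \<Rightarrow> real" where
  "exp_flat m s = (if s > 0 then inverse s ^ m / exp (inverse s) else 0)"

lemma exp_flat_pos: "s > 0 \<Longrightarrow> exp_flat m s > 0" by (simp add: exp_flat_def)

lemma exp_flat_nonneg: "exp_flat m s \<ge> 0" by (simp add: exp_flat_def)

lemma tendsto_exp_flat_0: "(exp_flat m \<longlongrightarrow> 0) (at 0)"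
proof -
  have "((\<lambda>s::real. inverse s ^ m / exp (inverse s)) \<longlongrightarrow> 0) (at_right 0)"
    using filterlim_compose[OF tendsto_power_div_exp_0 filterlim_inverse_at_top_right] .
  moreover have "eventually (\<lambda>s::real. inverse s ^ m / exp (inverse s) = exp_flat m s) (at_right 0)"
    unfolding eventually_at_right_field by (intro exI[of _ 1]) (auto simp: exp_flat_def)
  ultimately have R: "(exp_flat m \<longlongrightarrow> 0) (at_right 0)"
    by (rule Lim_transform_eventually)
  have "eventually (\<lambda>s::real. exp_flat m s = 0) (at_left 0)"
    unfolding eventually_at_left_field by (intro exI[of _ "-1"]) (auto simp: exp_flat_def)
  then have "(exp_flat m \<longlongrightarrow> 0) (at_left 0)"
    by (rule tendsto_eventually)
  with R show ?thesis by (simp add: filterlim_at_split)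
qed

text \<open>
  At \<open>s = 0\<close> the difference quotient of one member is the next member, which tends to \<open>0\<close>.
\<close>

lemma exp_flat_derivative:
  "(exp_flat m has_real_derivative exp_flat (m + 2) s - real m * exp_flat (m + 1) s) (at s)"
proof -
  consider "s > 0" | "s < 0" | "s = 0" by linarith
  then show ?thesis
  proof cases
    case 1
    have "((\<lambda>s. inverse s ^ m / exp (inverse s)) has_real_derivative
        exp_flat (m + 2) s - real m * exp_flat (m + 1) s) (at s)"
      using 1 by (auto intro!: derivative_eq_intros simp: exp_flat_def field_simps power2_eq_square)
        (cases m; simp add: field_simps)
    moreover have "eventually (\<lambda>x. x \<in> {0<..}) (nhds s)"
      using 1 by (intro eventually_nhds_in_open) auto
    ultimately show ?thesis
      by (subst DERIV_cong_ev[OF refl _ refl, where g="\<lambda>s. inverse s ^ m / exp (inverse s)"])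
        (auto simp: exp_flat_def elim!: eventually_mono)
  next
    case 2
    have "eventually (\<lambda>x. x \<in> {..<0}) (nhds s)"
      using 2 by (intro eventually_nhds_in_open) auto
    then show ?thesis using 2
      by (subst DERIV_cong_ev[OF refl _ refl, where g="\<lambda>s. 0"])
        (auto simp: exp_flat_def elim!: eventually_mono)
  next
    case 3
    have "exp_flat (m + 1) = (\<lambda>h. (exp_flat m (0 + h) - exp_flat m 0) / h)"
      by (auto simp: exp_flat_def fun_eq_iff divide_simps)
    then have "((\<lambda>h. (exp_flat m (0 + h) - exp_flat m 0) / h) \<longlongrightarrow> 0) (at 0)"
      using tendsto_exp_flat_0[of "m + 1"] by simp
    then show ?thesis
      by (simp only: DERIV_def 3) (simp add: exp_flat_def[of _ 0])
  qed
qed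

lemma smooth_exp_flat_compose:
  assumes "\<And>k. C_k k q"
  shows "C_k k (\<lambda>x. exp_flat m (q x))"
  by (rule C_k_compose_family[where F=exp_flat
        and D="\<lambda>m s. exp_flat (m + 2) s - real m * exp_flat (m + 1) s"])
    (rule exp_flat_derivative | rule C_k_diff C_k_cmult assms | assumption)+

definition bump :: "real \<Rightarrow> 'a::euclidean_space \<Rightarrow> real" where
  "bump r x = exp_flat 0 (1 - (norm x / r)\<^sup>2) / exp_flat 0 1"

lemma test_functionI:
  assumes "\<And>k. C_k k f" "\<And>x. x \<notin> K \<Longrightarrow> f x = 0" "bounded K"
  shows "test_function f"
proof -
  have "{x. f x \<noteq> 0} \<subseteq> K" using assms by auto
  with assms(3) have "bounded {x. f x \<noteq> 0}" by (rule bounded_subset)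
  then show ?thesis using assms(1) by (simp add: test_function_def compact_closure)
qed

lemma test_function_C_k: "test_function f \<Longrightarrow> C_k k f"
  by (simp add: test_function_def)

lemma test_function_bounded_support: "test_function f \<Longrightarrow> \<exists>r>0. \<forall>x. norm x \<ge> r \<longrightarrow> f x = 0"
proof -
  assume "test_function f"
  then have "bounded {x. f x \<noteq> 0}" by (simp add: test_function_def compact_closure)
  then obtain a where "\<And>x. f x \<noteq> 0 \<Longrightarrow> norm x \<le> a" by (auto simp: bounded_iff)
  then show ?thesis
    by (intro exI[of _ "\<bar>a\<bar> + 1"]) force
qed

lemma test_function_continuous_on: "test_function f \<Longrightarrow> continuous_on A f"
  using test_function_C_k[of f 0] by (auto intro: continuous_on_subset)

lemma test_function_derivative:
  "test_function f \<Longrightarrow> (f has_derivative frechet_derivative f (at x)) (at x)"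
  using test_function_C_k[of f 1] by (intro has_derivative_frechet) simp

lemma test_function_mult:
  assumes "test_function f" "\<And>k. C_k k g"
  shows "test_function (\<lambda>x. f x * g x)"
proof -
  have "bounded {x. f x \<noteq> 0}" using assms by (simp add: test_function_def compact_closure)
  then show ?thesis
    using C_k_mult[OF test_function_C_k[OF assms(1)] assms(2)]
    by (intro test_functionI[where K="{x. f x \<noteq> 0}"]) auto
qed

lemma bump_support: "r > 0 \<Longrightarrow> norm x \<ge> r \<Longrightarrow> bump r x = 0"
proof -
  assume "r > 0" "norm x \<ge> r"
  then have "norm x / r \<ge> 1" by simp
  then have "(norm x / r)\<^sup>2 \<ge> 1" by (simp add: one_le_power)
  then show "bump r x = 0" by (simp add: bump_def exp_flat_def)
qed

lemma bump_test_function: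
  assumes "r > 0"
  shows "test_function (bump r :: 'a::euclidean_space \<Rightarrow> real)"
proof (rule test_functionI[where K="cball 0 r"])
  fix k
  have "C_k k (\<lambda>x::'a. 1 - inverse r ^ 2 * (norm x)\<^sup>2)" for k
    by (intro C_k_diff C_k_cmult C_k_const C_k_norm_power2)
  then have "C_k k (\<lambda>x::'a. (1 / exp_flat 0 1) * exp_flat 0 (1 - inverse r ^ 2 * (norm x)\<^sup>2))"
    by (intro C_k_cmult smooth_exp_flat_compose)
  then show "C_k k (bump r :: 'a \<Rightarrow> real)"
    unfolding bump_def[abs_def] by (simp add: power_divide divide_simps power_inverse)
next
  fix x :: 'a assume "x \<notin> cball 0 r"
  then show "bump r x = 0" using assms by (intro bump_support) auto
qed simp

lemma bump_bounds: "0 \<le> bump r x" "bump r x \<le> 1" "bump r 0 = 1"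
proof -
  have e: "exp_flat 0 s \<le> exp_flat 0 1" if "s \<le> 1" for s
    using that by (auto simp: exp_flat_def field_simps)
  show "0 \<le> bump r x" by (simp add: bump_def exp_flat_nonneg)
  show "bump r x \<le> 1" using e[of "1 - (norm x / r)\<^sup>2"] exp_flat_pos[of 1 0]
    by (simp add: bump_def)
  show "bump r 0 = 1" using exp_flat_pos[of 1 0] by (simp add: bump_def)
qed


section \<open>Convolution with test functions\<close>

lemma distr_lborel_isometry:
  fixes a :: "'a::euclidean_space"
  assumes "\<bar>c\<bar> = 1"
  shows "distr lborel borel (\<lambda>x. a + c *\<^sub>R x) = lborel"
proof -
  have "c \<noteq> 0" using assms by auto
  from lborel_affine[OF this, of a] show ?thesis
    using assms by (simp add: density_1)
qed

lemma
  fixes f :: "'a::euclidean_space \<Rightarrow> 'b::{banach, second_countable_topology}"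
  assumes [measurable]: "f \<in> borel_measurable borel"
  shows integral_lborel_translate: "(LINT x|lborel. f (x - a)) = (LINT x|lborel. f x)"
    and integral_lborel_reflect: "(LINT x|lborel. f (a - x)) = (LINT x|lborel. f x)"
    and integrable_lborel_translate: "integrable lborel (\<lambda>x. f (x - a)) \<longleftrightarrow> integrable lborel f"
    and integrable_lborel_reflect: "integrable lborel (\<lambda>x. f (a - x)) \<longleftrightarrow> integrable lborel f"
proof -
  have 1: "(LINT x|lborel. f (c + d *\<^sub>R x)) = (LINT x|lborel. f x)"
    and 2: "integrable lborel (\<lambda>x. f (c + d *\<^sub>R x)) \<longleftrightarrow> integrable lborel f"
    if d: "\<bar>d\<bar> = 1" for c d
  proof -
    have "(LINT x|lborel. f x) = (LINT x|distr lborel borel (\<lambda>x. c + d *\<^sub>R x). f x)"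
      by (simp only: distr_lborel_isometry[OF d])
    also have "\<dots> = (LINT x|lborel. f (c + d *\<^sub>R x))"
      by (rule integral_distr) auto
    finally show "(LINT x|lborel. f (c + d *\<^sub>R x)) = (LINT x|lborel. f x)" ..
    have "integrable lborel f \<longleftrightarrow> integrable (distr lborel borel (\<lambda>x. c + d *\<^sub>R x)) f"
      by (simp only: distr_lborel_isometry[OF d])
    also have "\<dots> \<longleftrightarrow> integrable lborel (\<lambda>x. f (c + d *\<^sub>R x))"
      by (rule integrable_distr_eq) auto
    finally show "integrable lborel (\<lambda>x. f (c + d *\<^sub>R x)) \<longleftrightarrow> integrable lborel f" ..
  qed
  show "(LINT x|lborel. f (x - a)) = (LINT x|lborel. f x)"
    using 1[of 1 "- a"] by simp
  show "(LINT x|lborel. f (a - x)) = (LINT x|lborel. f x)"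
    using 1[of "- 1" a] by simp
  show "integrable lborel (\<lambda>x. f (x - a)) \<longleftrightarrow> integrable lborel f"
    using 2[of 1 "- a"] by simp
  show "integrable lborel (\<lambda>x. f (a - x)) \<longleftrightarrow> integrable lborel f"
    using 2[of "- 1" a] by simp
qed

lemma integral_lborel_dilate:
  fixes f :: "'a::euclidean_space \<Rightarrow> real"
  assumes [measurable]: "f \<in> borel_measurable borel" and R: "R > 0"
  shows "(LINT x|lborel. f (x /\<^sub>R R)) = R ^ DIM('a) * (LINT x|lborel. f x)"
proof -
  have "(LINT x|lborel. f (x /\<^sub>R R)) = (LINT x|density (distr lborel borel (\<lambda>x. 0 + R *\<^sub>R x)) (\<lambda>_. \<bar>R\<bar> ^ DIM('a)). f (x /\<^sub>R R))"
    using lborel_affine[of R "0::'a"] R by simp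
  also have "\<dots> = R ^ DIM('a) * (LINT x|lborel. f x)"
    using R by (simp add: integral_density integral_distr)
  finally show ?thesis .
qed

lemma has_derivative_grad:
  assumes "f differentiable (at x)"
  shows "(f has_derivative (\<lambda>h. grad f x \<bullet> h)) (at x)"
proof -
  let ?D = "frechet_derivative f (at x)"
  have D: "(f has_derivative ?D) (at x)" using assms frechet_derivative_works by blast
  have "?D h = grad f x \<bullet> h" for h
  proof -
    have "?D h = ?D (\<Sum>i\<in>Basis. (h \<bullet> i) *\<^sub>R i)" by (simp add: euclidean_representation)
    also have "\<dots> = (\<Sum>i\<in>Basis. (h \<bullet> i) * ?D i)"
      using has_derivative_linear[OF D] by (simp add: linear_sum linear_scale)
    also have "\<dots> = grad f x \<bullet> h"
      by (simp add: grad_def inner_sum_left inner_commute[of h] mult.commute[of _ "frechet_derivative f (at x) _"])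
    finally show ?thesis .
  qed
  with D show ?thesis by (metis ext)
qed

lemma grad_eqI:
  assumes "(f has_derivative (\<lambda>h. g \<bullet> h)) (at x)"
  shows "grad f x = g"
proof -
  have "frechet_derivative f (at x) = (\<lambda>h. g \<bullet> h)" using frechet_derivative_at[OF assms] by simp
  then show ?thesis by (simp add: grad_def euclidean_representation)
qed

lemma test_function_grad:
  "test_function f \<Longrightarrow> (f has_derivative (\<lambda>h. grad f x \<bullet> h)) (at x)"
  by (rule has_derivative_grad) (auto simp: differentiable_def dest: test_function_derivative)

lemma test_function_partial:
  assumes f: "test_function f" and i: "i \<in> Basis"
  shows "test_function (\<lambda>x. grad f x \<bullet> i)"
proof -
  have eq: "grad f x \<bullet> i = frechet_derivative f (at x) i" for x
    using i by (simp add: grad_def inner_sum_left_Basis)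
  obtain r where r: "r > 0" "\<And>x. norm x \<ge> r \<Longrightarrow> f x = 0"
    using test_function_bounded_support[OF f] by auto
  show ?thesis
  proof (rule test_functionI)
    show "C_k k (\<lambda>x. grad f x \<bullet> i)" for k
      using test_function_C_k[OF f, of "Suc k"] i by (simp add: eq)
    show "bounded (cball (0::'a) r)" by simp
    show "grad f x \<bullet> i = 0" if "x \<notin> cball 0 r" for x
    proof -
      have "eventually (\<lambda>x. x \<in> - cball 0 r) (nhds x)"
        using that by (intro eventually_nhds_in_open) auto
      then have ev: "eventually (\<lambda>x. f x = 0) (nhds x)"
        by eventually_elim (auto intro: r)
      have "eventually (\<lambda>x. 0 = f x) (at x)"
        using ev by (auto simp: eventually_at_filter elim!: eventually_mono)
      then have "(f has_derivative (\<lambda>h. 0 \<bullet> h)) (at x)"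
        using eventually_nhds_x_imp_x[OF ev]
        by (intro has_derivative_transform_eventually[of "\<lambda>_. 0" "\<lambda>h. 0 \<bullet> h" x UNIV f]) auto
      then show ?thesis using grad_eqI by fastforce
    qed
  qed
qed

lemma test_function_grad_continuous:
  "test_function f \<Longrightarrow> continuous_on A (grad f)"
  by (subst continuous_on_componentwise) (auto intro: test_function_continuous_on test_function_partial)

lemma test_function_grad_bounded_support:
  assumes "test_function f"
  shows "\<exists>r>0. \<forall>x. norm x \<ge> r \<longrightarrow> grad f x = 0"
proof -
  have "\<forall>i\<in>Basis. \<exists>r>0. \<forall>x. norm x \<ge> r \<longrightarrow> grad f x \<bullet> i = 0"
    using test_function_bounded_support[OF test_function_partial[OF assms]] by auto
  then obtain r where r: "\<And>i. i \<in> Basis \<Longrightarrow> r i > 0 \<and> (\<forall>x. norm x \<ge> r i \<longrightarrow> grad f x \<bullet> i = 0)"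
    by metis
  show ?thesis
  proof (intro exI[of _ "Max (r ` Basis)"] conjI allI impI)
    obtain j :: 'a where j: "j \<in> Basis" using nonempty_Basis by blast
    then have "r j \<le> Max (r ` Basis)" by simp
    with r[OF j] show "0 < Max (r ` Basis)" by linarith
    fix x :: 'a assume "Max (r ` Basis) \<le> norm x"
    then have "\<forall>i\<in>Basis. grad f x \<bullet> i = 0" using r by auto
    then show "grad f x = 0" using euclidean_eqI[of "grad f x" 0] by simp
  qed
qed

lemma bounded_support_bounded:
  fixes f :: "'a::euclidean_space \<Rightarrow> 'b::real_normed_vector"
  assumes "continuous_on UNIV f" "\<And>x. norm x \<ge> r \<Longrightarrow> f x = 0"
  obtains B where "B > 0" "\<And>x. norm (f x) \<le> B"
proof -
  have "compact (f ` cball 0 r)"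
    by (intro compact_continuous_image continuous_on_subset[OF assms(1)]) auto
  then obtain B where B: "\<And>x. norm x \<le> r \<Longrightarrow> norm (f x) \<le> B"
    by (metis compact_imp_bounded bounded_iff imageI mem_cball_0)
  show thesis
  proof (rule that[of "\<bar>B\<bar> + 1"])
    show "norm (f x) \<le> \<bar>B\<bar> + 1" for x
      using B[of x] assms(2)[of x] by (cases "norm x \<le> r") auto
  qed simp
qed

lemma bounded_support_uniformly_continuous:
  fixes f :: "'a::euclidean_space \<Rightarrow> 'b::real_normed_vector"
  assumes "continuous_on UNIV f" "\<And>x. norm x \<ge> r \<Longrightarrow> f x = 0" "e > 0"
  shows "\<exists>d>0. \<forall>x y. norm (x - y) < d \<longrightarrow> norm (f x - f y) < e"
proof -
  have "uniformly_continuous_on (cball 0 (r + 1)) f"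
    by (intro compact_uniformly_continuous continuous_on_subset[OF assms(1)]) auto
  then obtain d where d: "d > 0" "\<And>x y. norm x \<le> r + 1 \<Longrightarrow> norm y \<le> r + 1 \<Longrightarrow> norm (x - y) < d \<Longrightarrow> norm (f x - f y) < e"
    using \<open>e > 0\<close> unfolding uniformly_continuous_on_def dist_norm by (metis dist_0_norm mem_cball)
  show ?thesis
  proof (intro exI[of _ "min d 1"] conjI allI impI)
    fix x y :: 'a assume xy: "norm (x - y) < min d 1"
    then have "norm x \<le> norm y + 1" "norm y \<le> norm x + 1"
      using norm_triangle_ineq2[of x y] norm_triangle_ineq2[of y x] norm_minus_commute[of x y] by linarith+
    then show "norm (f x - f y) < e"
      using d(2)[of x y] xy assms(2)[of x] assms(2)[of y] \<open>e > 0\<close>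
      by (cases "norm x \<ge> r \<and> norm y \<ge> r") auto
  qed (use d in auto)
qed

text \<open>
  The error of the linear approximation is small uniformly in the base point, because the gradient
  is uniformly continuous. This allows differentiation under the integral sign against an arbitrary
  integrable function in \<open>convolve_has_derivative\<close>.
\<close>

lemma test_function_uniform_linearization:
  assumes f: "test_function f" and "e > 0"
  shows "\<exists>d>0. \<forall>x h. norm h < d \<longrightarrow> \<bar>f (x + h) - f x - grad f x \<bullet> h\<bar> \<le> e * norm h"
proof -
  obtain r where "\<And>x. norm x \<ge> r \<Longrightarrow> grad f x = 0"
    using test_function_grad_bounded_support[OF f] by auto
  then obtain d where d: "d > 0" "\<And>x y. norm (x - y) < d \<Longrightarrow> norm (grad f x - grad f y) < e"
    using bounded_support_uniformly_continuous[OF test_function_grad_continuous[OF f] _ \<open>e > 0\<close>] by metis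
  have "\<bar>f (x + h) - f x - grad f x \<bullet> h\<bar> \<le> e * norm h" if "norm h < d" for x h
  proof -
    have "norm (f (x + h) - f x - (grad f x \<bullet> ((x + h) - x))) \<le> norm ((x + h) - x) * e"
    proof (rule differentiable_bound_linearization[where S="ball x d" and f'="\<lambda>x h. grad f x \<bullet> h"])
      show "x + t *\<^sub>R ((x + h) - x) \<in> ball x d" if "t \<in> {0..1}" for t
        using that \<open>norm h < d\<close> mult_left_le_one_le[of "norm h" t] by (auto simp: dist_norm)
      show "(f has_derivative (\<bullet>) (grad f y)) (at y within ball x d)" for y
        using test_function_grad[OF f] by (rule has_derivative_at_withinI)
      fix y assume "y \<in> ball x d"
      then have "norm (grad f y - grad f x) \<le> e" using d(2)[of y x] by (simp add: dist_norm norm_minus_commute)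
      then have "norm ((grad f y - grad f x) \<bullet> h) \<le> e * norm h" for h
        using order.trans[OF Cauchy_Schwarz_ineq2 mult_right_mono[OF _ norm_ge_zero]] by auto
      then show "onorm ((\<bullet>) (grad f y) - (\<bullet>) (grad f x)) \<le> e"
        using \<open>e > 0\<close> by (intro onorm_bound) (auto simp: inner_diff_left)
    qed (use d in auto)
    then show ?thesis by (simp add: mult.commute)
  qed
  with d(1) show ?thesis by blast
qed

definition convolve :: "('a::euclidean_space \<Rightarrow> real) \<Rightarrow> ('a \<Rightarrow> 'b) \<Rightarrow> 'a \<Rightarrow> 'b::{banach, second_countable_topology}"
  where "convolve \<rho> f x = (LINT y|lborel. \<rho> (x - y) *\<^sub>R f y)"

lemma test_function_measurable[measurable_dest]: "test_function f \<Longrightarrow> f \<in> borel_measurable borel"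
  by (intro borel_measurable_continuous_onI test_function_continuous_on)

lemma test_function_grad_measurable: "test_function f \<Longrightarrow> grad f \<in> borel_measurable borel"
  by (intro borel_measurable_continuous_onI test_function_grad_continuous)

lemma test_function_bounded:
  assumes "test_function f" obtains B where "B > 0" "\<And>x. \<bar>f x\<bar> \<le> B"
  using bounded_support_bounded[of f] test_function_bounded_support[OF assms]
    test_function_continuous_on[OF assms] by (metis real_norm_def)

lemma test_function_grad_bounded:
  assumes "test_function f" obtains B where "B > 0" "\<And>x. norm (grad f x) \<le> B"
  using bounded_support_bounded[of "grad f"] test_function_grad_bounded_support[OF assms]
    test_function_grad_continuous[OF assms] by metis

lemma integrable_bounded_scaleR:
  fixes f :: "'a \<Rightarrow> 'b::{banach, second_countable_topology}" and g :: "'a \<Rightarrow> real"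
  assumes f: "integrable M f" and [measurable]: "g \<in> borel_measurable M" and g: "\<And>x. \<bar>g x\<bar> \<le> B"
  shows "integrable M (\<lambda>x. g x *\<^sub>R f x)"
proof (rule Bochner_Integration.integrable_bound[where f="\<lambda>x. B * norm (f x)"])
  have "norm (g x *\<^sub>R f x) \<le> norm (B * norm (f x))" for x
    using g[of x] by (simp add: abs_mult mult_right_mono order.trans[OF _ abs_ge_self])
  then show "AE x in M. norm (g x *\<^sub>R f x) \<le> norm (B * norm (f x))" by simp
qed (use f in auto)

lemma integrable_scaleR_bounded:
  fixes f :: "'a \<Rightarrow> real" and g :: "'a \<Rightarrow> 'b::{banach, second_countable_topology}"
  assumes f: "integrable M f" and [measurable]: "g \<in> borel_measurable M" and g: "\<And>x. norm (g x) \<le> B"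
  shows "integrable M (\<lambda>x. f x *\<^sub>R g x)"
proof (rule Bochner_Integration.integrable_bound[where f="\<lambda>x. B * f x"])
  have "norm (f x *\<^sub>R g x) \<le> norm (B * f x)" for x
    using mult_right_mono[OF order.trans[OF g abs_ge_self], of "\<bar>f x\<bar>" x]
    by (simp add: abs_mult mult.commute)
  then show "AE x in M. norm (f x *\<^sub>R g x) \<le> norm (B * f x)" by simp
qed (use f in auto)

lemma integrable_bounded_support:
  fixes f :: "'a::euclidean_space \<Rightarrow> 'b::{banach, second_countable_topology}"
  assumes "continuous_on UNIV f" "\<And>x. norm x \<ge> r \<Longrightarrow> f x = 0"
  shows "integrable lborel f"
proof -
  obtain B where B: "\<And>x. norm (f x) \<le> B"
    using bounded_support_bounded[OF assms] by metis
  show ?thesis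
  proof (rule Bochner_Integration.integrable_bound[where f="\<lambda>x. B * indicator (cball 0 r) x"])
    show "integrable lborel (\<lambda>x. B * indicator (cball 0 r) x)"
      using emeasure_lborel_cball_finite[of 0 r] by (intro integrable_mult_right integrable_real_indicator) auto
    show "f \<in> borel_measurable lborel"
      using borel_measurable_continuous_onI[OF assms(1)] by simp
    have "norm (f x) \<le> norm (B * indicator (cball 0 r) x)" for x
      using B[of x] assms(2)[of x] by (cases "norm x \<le> r") (auto intro: order.trans[OF _ abs_ge_self])
    then show "AE x in lborel. norm (f x) \<le> norm (B * indicator (cball 0 r) x)" by simp
  qed
qed

lemma test_function_integrable: "test_function f \<Longrightarrow> integrable lborel f"
  using test_function_bounded_support test_function_continuous_on integrable_bounded_support by metis

lemma convolve_reflect: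
  fixes f :: "'a::euclidean_space \<Rightarrow> 'b::{banach, second_countable_topology}"
  assumes [measurable]: "\<rho> \<in> borel_measurable borel" "f \<in> borel_measurable borel"
  shows "convolve \<rho> f x = (LINT y|lborel. \<rho> y *\<^sub>R f (x - y))"
  using integral_lborel_reflect[of "\<lambda>y. \<rho> y *\<^sub>R f (x - y)" x] by (simp add: convolve_def)

lemma integrable_scaleR_test_grad:
  assumes \<rho>: "test_function \<rho>" and f: "integrable lborel f"
  shows "integrable lborel (\<lambda>y. f y *\<^sub>R grad \<rho> (x - y))"
proof -
  note [measurable] = test_function_grad_measurable[OF \<rho>]
  obtain B where "\<And>x. norm (grad \<rho> x) \<le> B" using test_function_grad_bounded[OF \<rho>] by metis
  then show ?thesis by (intro integrable_scaleR_bounded[OF f]) auto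
qed

lemma convolve_has_derivative:
  fixes f :: "'a::euclidean_space \<Rightarrow> real"
  assumes \<rho>: "test_function \<rho>" and f: "integrable lborel f"
  shows "(convolve \<rho> f has_derivative (\<lambda>h. (LINT y|lborel. f y *\<^sub>R grad \<rho> (x - y)) \<bullet> h)) (at x)"
proof -
  note [measurable] = test_function_measurable[OF \<rho>] test_function_grad_measurable[OF \<rho>]
  have [measurable]: "f \<in> borel_measurable borel" using f by auto
  obtain B where B: "\<And>x. \<bar>\<rho> x\<bar> \<le> B" using test_function_bounded[OF \<rho>] by metis
  have i1: "integrable lborel (\<lambda>y. \<rho> (z - y) * f y)" for z
    using integrable_bounded_scaleR[OF f, of "\<lambda>y. \<rho> (z - y)" B] B by simp
  note i2 = integrable_scaleR_test_grad[OF \<rho> f]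
  let ?N = "LINT y|lborel. \<bar>f y\<bar>"
  show ?thesis
    unfolding has_derivative_at_alt
  proof (intro conjI allI impI bounded_linear_inner_right)
    fix e :: real assume "e > 0"
    have N: "?N \<ge> 0" by simp
    define e' where "e' = e / (?N + 1)"
    have e': "e' > 0" "e' * ?N \<le> e"
      using \<open>e > 0\<close> N by (auto simp: e'_def field_simps add_pos_nonneg)
    obtain d where d: "d > 0" "\<And>x h. norm h < d \<Longrightarrow> \<bar>\<rho> (x + h) - \<rho> x - grad \<rho> x \<bullet> h\<bar> \<le> e' * norm h"
      using test_function_uniform_linearization[OF \<rho> e'(1)] by auto
    have "norm (convolve \<rho> f z - convolve \<rho> f x - (LINT y|lborel. f y *\<^sub>R grad \<rho> (x - y)) \<bullet> (z - x)) \<le> e * norm (z - x)"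
      if z: "norm (z - x) < d" for z
    proof -
      define h where "h = z - x"
      have "convolve \<rho> f z - convolve \<rho> f x - (LINT y|lborel. f y *\<^sub>R grad \<rho> (x - y)) \<bullet> (z - x)
        = (LINT y|lborel. \<rho> (z - y) * f y - \<rho> (x - y) * f y - (f y *\<^sub>R grad \<rho> (x - y)) \<bullet> h)"
        using i1 i2 integral_inner_left[OF i2, of h x] integrable_inner_left[OF i2, of h x]
        by (simp add: convolve_def h_def[symmetric] del: inner_scaleR_left)
      also have "norm \<dots> \<le> (LINT y|lborel. e' * norm h * \<bar>f y\<bar>)"
      proof (rule Bochner_Integration.integral_norm_bound_integral)
        fix y
        have "z - y = (x - y) + h" by (simp add: h_def)
        then have "\<bar>\<rho> (z - y) - \<rho> (x - y) - grad \<rho> (x - y) \<bullet> h\<bar> \<le> e' * norm h"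
          using d(2)[of h "x - y"] z by (simp add: h_def)
        then have "\<bar>\<rho> (z - y) - \<rho> (x - y) - grad \<rho> (x - y) \<bullet> h\<bar> * \<bar>f y\<bar> \<le> e' * norm h * \<bar>f y\<bar>"
          by (rule mult_right_mono) simp
        then show "norm (\<rho> (z - y) * f y - \<rho> (x - y) * f y - (f y *\<^sub>R grad \<rho> (x - y)) \<bullet> h) \<le> e' * norm h * \<bar>f y\<bar>"
          by (simp add: abs_mult[symmetric] algebra_simps)
      qed (intro Bochner_Integration.integrable_diff integrable_inner_left i1 i2, use f in simp)
      also have "\<dots> = (e' * ?N) * norm h" by simp
      also have "\<dots> \<le> e * norm h" using e' by (intro mult_right_mono) auto
      finally show ?thesis by (simp add: h_def)
    qed
    with d(1) show "\<exists>d>0. \<forall>z. norm (z - x) < d \<longrightarrow>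
       norm (convolve \<rho> f z - convolve \<rho> f x - (LINT y|lborel. f y *\<^sub>R grad \<rho> (x - y)) \<bullet> (z - x)) \<le> e * norm (z - x)"
      by blast
  qed
qed

text \<open>
  All derivatives fall on the smooth factor, and partial derivatives of test functions are again test
  functions.
\<close>

lemma convolve_C_k:
  fixes f :: "'a::euclidean_space \<Rightarrow> real"
  assumes "test_function \<rho>" and f: "integrable lborel f"
  shows "C_k k (convolve \<rho> f)"
  using assms(1)
proof (induction k arbitrary: \<rho>)
  case 0
  have "continuous (at x) (convolve \<rho> f)" for x
    using convolve_has_derivative[OF 0 f] by (rule has_derivative_continuous)
  then show ?case by (auto intro: continuous_at_imp_continuous_on)
next
  case (Suc k)
  show ?case
  proof (rule C_k_SucI[OF convolve_has_derivative[OF Suc.prems f]])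
    fix i :: 'a assume i: "i \<in> Basis"
    have "(\<lambda>x. (LINT y|lborel. f y *\<^sub>R grad \<rho> (x - y)) \<bullet> i) = convolve (\<lambda>z. grad \<rho> z \<bullet> i) f"
      using integrable_scaleR_test_grad[OF Suc.prems f] by (simp add: fun_eq_iff convolve_def mult.commute flip: integral_inner_left)
    then show "C_k k (\<lambda>x. (LINT y|lborel. f y *\<^sub>R grad \<rho> (x - y)) \<bullet> i)"
      using Suc.IH[OF test_function_partial[OF Suc.prems i]] by simp
  qed
qed


section \<open>Mollification in \<open>L\<^sup>1\<close>\<close>

text \<open>
  By approximation with simple functions it suffices to treat an indicator function of a set \<open>A\<close> of
  finite measure. The integral of \<open>\<bar>1\<^sub>A(x - y) - 1\<^sub>A(x)\<bar>\<close> is twice that of the positive part of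
  \<open>1\<^sub>A(x) - 1\<^sub>A(x - y)\<close>, since translation does not change the measure of \<open>A\<close>. For an open \<open>U \<supseteq> A\<close>
  with \<open>U - A\<close> of small measure, the positive part is at most \<open>1\<^sub>A(x) (1 - 1\<^sub>U(x - y))\<close> plus the
  indicator of \<open>U - A\<close> at \<open>x - y\<close>. The latter has small integral, and the former tends to \<open>0\<close> pointwise as \<open>y \<rightarrow> 0\<close> because \<open>U\<close> is open.
\<close>

lemma translation_continuous_L1:
  fixes f :: "'a::euclidean_space \<Rightarrow> 'b::{banach, second_countable_topology}"
  assumes "integrable lborel f" and y: "y \<longlonglongrightarrow> 0"
  shows "(\<lambda>n. LINT x|lborel. norm (f (x - y n) - f x)) \<longlonglongrightarrow> 0"
  using assms(1)
proof (induction f rule: integrable_induct)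
  case (base A c)
  have [measurable]: "A \<in> sets borel" using base by simp
  have iA: "integrable lborel (indicat_real A)" using base by simp
  define a where "a n = (LINT x|lborel. \<bar>indicat_real A (x - y n) - indicat_real A x\<bar>)" for n
  have "a \<longlonglongrightarrow> 0"
  proof (rule LIMSEQ_I)
    fix e :: real assume "e > 0"
    obtain U where U: "open U" "A \<subseteq> U" "(U - A) \<in> lmeasurable" "emeasure lebesgue (U - A) < ennreal (e / 4)"
      using sets_lebesgue_outer_open[of A "e / 4"] \<open>e > 0\<close> base by auto
    have [measurable]: "U \<in> sets borel" using U by simp
    have emU: "emeasure lborel (U - A) < ennreal (e / 4)" using U(4) by simp
    then have iU: "integrable lborel (indicat_real (U - A))"
      by (intro integrable_real_indicator) (auto intro: order.strict_trans)
    have mU: "(LINT x|lborel. indicat_real (U - A) x) < e / 4"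
    proof -
      have "emeasure lborel (U - A) = ennreal (measure lborel (U - A))"
        using emU by (intro emeasure_eq_ennreal_measure) auto
      with emU show ?thesis by (simp add: ennreal_less_iff)
    qed
    have "(\<lambda>n. LINT x|lborel. indicat_real A x * (1 - indicat_real U (x - y n))) \<longlonglongrightarrow> (LINT x::'a|lborel. (0::real))"
    proof (rule integral_dominated_convergence[where w="indicat_real A" and f="\<lambda>_. 0"
          and s="\<lambda>n x. indicat_real A x * (1 - indicat_real U (x - y n))"])
      have "(\<lambda>n. indicat_real A x * (1 - indicat_real U (x - y n))) \<longlonglongrightarrow> 0" for x
      proof (cases "x \<in> A")
        case True
        have "(\<lambda>n. x - y n) \<longlonglongrightarrow> x" using tendsto_diff[OF tendsto_const y, of x] by simp
        then have "eventually (\<lambda>n. x - y n \<in> U) sequentially"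
          using True U by (intro topological_tendstoD) auto
        then have "eventually (\<lambda>n. indicat_real A x * (1 - indicat_real U (x - y n)) = 0) sequentially"
          by eventually_elim simp
        then show ?thesis by (rule tendsto_eventually)
      qed simp
      then show "AE x in lborel. (\<lambda>n. indicat_real A x * (1 - indicat_real U (x - y n))) \<longlonglongrightarrow> 0" by simp
    qed (auto simp: iA indicator_def)
    then obtain N where N: "\<And>n. n \<ge> N \<Longrightarrow> (LINT x|lborel. indicat_real A x * (1 - indicat_real U (x - y n))) < e / 4"
      using order_tendstoD(2)[of _ "0::real" sequentially "e / 4"] \<open>e > 0\<close> by (auto simp: eventually_sequentially)
    have "a n < e" if "n \<ge> N" for n
    proof -
      have iA': "integrable lborel (\<lambda>x. indicat_real A (x - y n))"
        and iU': "integrable lborel (\<lambda>x. indicat_real (U - A) (x - y n))"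
        using iA iU by (simp_all add: integrable_lborel_translate)
      have i3: "integrable lborel (\<lambda>x. indicat_real A x * (1 - indicat_real U (x - y n)))"
        by (rule Bochner_Integration.integrable_bound[OF iA]) (auto simp: indicator_def)
      have "a n \<le> (LINT x|lborel. 2 * (indicat_real A x * (1 - indicat_real U (x - y n)) + indicat_real (U - A) (x - y n))
          - (indicat_real A x - indicat_real A (x - y n)))"
        unfolding a_def
      proof (rule integral_mono)
        show "integrable lborel (\<lambda>x. \<bar>indicat_real A (x - y n) - indicat_real A x\<bar>)"
          using iA iA' by simp
        show "integrable lborel (\<lambda>x. 2 * (indicat_real A x * (1 - indicat_real U (x - y n)) + indicat_real (U - A) (x - y n))
          - (indicat_real A x - indicat_real A (x - y n)))"
          using iA iA' i3 iU' by simp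
      qed (use U(2) in \<open>auto simp: indicator_def\<close>)
      also have "\<dots> = 2 * ((LINT x|lborel. indicat_real A x * (1 - indicat_real U (x - y n))) + (LINT x|lborel. indicat_real (U - A) (x - y n)))
          - ((LINT x|lborel. indicat_real A x) - (LINT x|lborel. indicat_real A (x - y n)))"
        using iA iA' i3 iU' by simp
      also have "(LINT x|lborel. indicat_real A (x - y n)) = (LINT x|lborel. indicat_real A x)"
        by (rule integral_lborel_translate) auto
      also have "(LINT x|lborel. indicat_real (U - A) (x - y n)) = (LINT x|lborel. indicat_real (U - A) x)"
        by (rule integral_lborel_translate) auto
      finally show ?thesis using N[OF that] mU by simp
    qed
    moreover have "a n \<ge> 0" for n by (simp add: a_def)
    ultimately show "\<exists>N. \<forall>n\<ge>N. norm (a n - 0) < e" by (intro exI[of _ N]) auto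
  qed
  then have "(\<lambda>n. a n * norm c) \<longlonglongrightarrow> 0" by (rule tendsto_mult_left_zero)
  moreover have "(LINT x|lborel. norm (indicator A (x - y n) *\<^sub>R c - indicator A x *\<^sub>R c)) = a n * norm c" for n
    unfolding a_def by (simp flip: scaleR_diff_left)
  ultimately show ?case by simp
next
  case (add f g)
  have [measurable]: "f \<in> borel_measurable borel" "g \<in> borel_measurable borel" using add by auto
  have i: "integrable lborel (\<lambda>x. f (x - y n))" "integrable lborel (\<lambda>x. g (x - y n))" for n
    using add by (simp_all add: integrable_lborel_translate)
  show ?case
  proof (rule tendsto_sandwich[OF _ _ tendsto_const])
    show "(\<lambda>n. (LINT x|lborel. norm (f (x - y n) - f x)) + (LINT x|lborel. norm (g (x - y n) - g x))) \<longlonglongrightarrow> 0"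
      using tendsto_add[OF add(3,4)] by simp
    have "(LINT x|lborel. norm (f (x - y n) + g (x - y n) - (f x + g x)))
      \<le> (LINT x|lborel. norm (f (x - y n) - f x) + norm (g (x - y n) - g x))" for n
      using i add by (intro integral_mono) (auto intro: norm_diff_triangle_ineq)
    also have "\<dots> n = (LINT x|lborel. norm (f (x - y n) - f x)) + (LINT x|lborel. norm (g (x - y n) - g x))" for n
      using i add by (intro Bochner_Integration.integral_add) auto
    finally show "eventually (\<lambda>n. (LINT x|lborel. norm (f (x - y n) + g (x - y n) - (f x + g x)))
      \<le> (LINT x|lborel. norm (f (x - y n) - f x)) + (LINT x|lborel. norm (g (x - y n) - g x))) sequentially"
      by simp
  qed simp
next
  case (lim f s)
  have conv: "(\<lambda>i. s i x) \<longlonglongrightarrow> f x" and bnd: "norm (s i x) \<le> 2 * norm (f x)" for i x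
    using lim by auto
  have IH: "(\<lambda>n. LINT x|lborel. norm (s i (x - y n) - s i x)) \<longlonglongrightarrow> 0" for i
    using lim by auto
  have [measurable]: "f \<in> borel_measurable borel" "s i \<in> borel_measurable borel" for i using lim by auto
  have iy: "integrable lborel (\<lambda>x. f (x - y n))" "integrable lborel (\<lambda>x. s i (x - y n))" for n i
    using lim by (simp_all add: integrable_lborel_translate)
  have "(\<lambda>i. LINT x|lborel. norm (s i x - f x)) \<longlonglongrightarrow> (LINT x::'a|lborel. (0::real))"
  proof (rule integral_dominated_convergence[where w="\<lambda>x. 3 * norm (f x)"])
    show "AE x in lborel. (\<lambda>i. norm (s i x - f x)) \<longlonglongrightarrow> 0"
      using conv by (simp add: tendsto_norm_zero_iff LIM_zero_iff)
    fix i
    have "norm (s i x - f x) \<le> 3 * norm (f x)" for x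
      using bnd[of i x] norm_triangle_ineq4[of "s i x" "f x"] by simp
    then show "AE x in lborel. norm (norm (s i x - f x)) \<le> 3 * norm (f x)" by simp
  qed (use lim in auto)
  then have L: "(\<lambda>i. LINT x|lborel. norm (s i x - f x)) \<longlonglongrightarrow> 0" by simp
  show ?case
  proof (rule LIMSEQ_I)
    fix e :: real assume "e > 0"
    obtain i where i: "(LINT x|lborel. norm (s i x - f x)) < e / 4"
      using order_tendstoD(2)[OF L, of "e / 4"] \<open>e > 0\<close> by (auto simp: eventually_sequentially)
    obtain N where N: "\<And>n. n \<ge> N \<Longrightarrow> (LINT x|lborel. norm (s i (x - y n) - s i x)) < e / 4"
      using order_tendstoD(2)[OF IH[of i], of "e / 4"] \<open>e > 0\<close> by (auto simp: eventually_sequentially)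
    have "(LINT x|lborel. norm (f (x - y n) - f x)) < e" if "n \<ge> N" for n
    proof -
      have "(LINT x|lborel. norm (f (x - y n) - f x)) \<le>
        (LINT x|lborel. (norm (s i (x - y n) - f (x - y n)) + norm (s i x - f x)) + norm (s i (x - y n) - s i x))"
      proof (intro integral_mono)
        fix x
        have "norm (f (x - y n) - f x) \<le> norm (f (x - y n) - s i (x - y n)) + norm (s i (x - y n) - s i x) + norm (s i x - f x)"
          using norm_triangle_ineq[of "f (x - y n) - s i (x - y n)" "s i (x - y n) - s i x"]
            norm_triangle_ineq[of "f (x - y n) - s i (x - y n) + (s i (x - y n) - s i x)" "s i x - f x"]
          by simp
        then show "norm (f (x - y n) - f x) \<le> (norm (s i (x - y n) - f (x - y n)) + norm (s i x - f x)) + norm (s i (x - y n) - s i x)"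
          by (simp add: norm_minus_commute)
      qed (use iy lim in auto)
      also have "\<dots> = ((LINT x|lborel. norm (s i (x - y n) - f (x - y n))) + (LINT x|lborel. norm (s i x - f x)))
        + (LINT x|lborel. norm (s i (x - y n) - s i x))"
        using iy lim by simp
      also have "(LINT x|lborel. norm (s i (x - y n) - f (x - y n))) = (LINT x|lborel. norm (s i x - f x))"
        by (rule integral_lborel_translate[where f="\<lambda>x. norm (s i x - f x)"]) auto
      finally show ?thesis using i N[OF that] \<open>e > 0\<close> by simp
    qed
    then show "\<exists>N. \<forall>n\<ge>N. norm ((LINT x|lborel. norm (f (x - y n) - f x)) - 0) < e"
      by (intro exI[of _ N]) auto
  qed
qed

text \<open>
  Fubini's theorem: the double integral of \<open>\<bar>\<rho>(x - y)\<bar> \<bar>f(y)\<bar>\<close> is the product of the two norms.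
\<close>

lemma convolve_integrable:
  fixes f :: "'a::euclidean_space \<Rightarrow> 'b::euclidean_space"
  assumes \<rho>: "integrable lborel \<rho>" and f: "integrable lborel f"
  shows "integrable lborel (convolve \<rho> f)"
proof -
  have [measurable]: "\<rho> \<in> borel_measurable borel" "f \<in> borel_measurable borel" using \<rho> f by auto
  have i: "integrable lborel (\<lambda>x. \<rho> (x - y))" for y
    using \<rho> by (simp add: integrable_lborel_translate)
  have "integrable (lborel \<Otimes>\<^sub>M lborel) (\<lambda>(y, x). \<rho> (x - y) *\<^sub>R f y)"
  proof (rule lborel_pair.Fubini_integrable)
    have "(LINT x|lborel. \<bar>\<rho> (x - y)\<bar>) = (LINT x|lborel. \<bar>\<rho> x\<bar>)" for y
      by (rule integral_lborel_translate[where f="\<lambda>x. \<bar>\<rho> x\<bar>"]) simp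
    then show "integrable lborel (\<lambda>y. LINT x|lborel. norm (case (y, x) of (y, x) \<Rightarrow> \<rho> (x - y) *\<^sub>R f y))"
      using f by simp
    show "AE y in lborel. integrable lborel (\<lambda>x. case (y, x) of (y, x) \<Rightarrow> \<rho> (x - y) *\<^sub>R f y)"
      using i by simp
  qed measurable
  from lborel_pair.integrable_snd[OF this] show ?thesis
    by (simp add: convolve_def[abs_def])
qed

text \<open>
  The difference \<open>\<rho> * f - f\<close> is an average, with weight \<open>\<rho>\<close>, of the differences between \<open>f\<close> and its
  translates. Fubini's theorem bounds its norm by the average of their norms.
\<close>

lemma convolve_L1_dist_le:
  fixes f :: "'a::euclidean_space \<Rightarrow> 'b::euclidean_space"
  assumes \<rho>: "integrable lborel \<rho>" "\<And>y. \<rho> y \<ge> 0" "(LINT y|lborel. \<rho> y) = 1"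
    and f: "integrable lborel f"
    and \<omega>: "\<And>y. \<rho> y \<noteq> 0 \<Longrightarrow> (LINT x|lborel. norm (f (x - y) - f x)) \<le> e"
    and bnd: "\<And>y. \<rho> y \<le> B"
  shows "(LINT x|lborel. norm (convolve \<rho> f x - f x)) \<le> e"
proof -
  have [measurable]: "\<rho> \<in> borel_measurable borel" "f \<in> borel_measurable borel" using \<rho> f by auto
  have fy: "integrable lborel (\<lambda>x. f (x - y))" and fx: "integrable lborel (\<lambda>y. f (x - y))" for x y
    using f by (simp_all add: integrable_lborel_translate integrable_lborel_reflect)
  define k where "k y x = \<rho> y * norm (f (x - y) - f x)" for y x
  have [measurable]: "(\<lambda>(y, x). k y x) \<in> borel_measurable (borel \<Otimes>\<^sub>M borel)"
    unfolding k_def by measurable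
  have kle: "(LINT x|lborel. k y x) \<le> \<rho> y * e" for y
    using \<omega>[of y] \<rho>(2)[of y] by (cases "\<rho> y = 0") (auto simp: k_def intro: mult_left_mono)
  have k0: "k y x \<ge> 0" for y x using \<rho>(2) by (simp add: k_def)
  have I: "integrable (lborel \<Otimes>\<^sub>M lborel) (\<lambda>(y, x). k y x)"
  proof (rule lborel_pair.Fubini_integrable)
    show "integrable lborel (\<lambda>y. LINT x|lborel. norm (case (y, x) of (y, x) \<Rightarrow> k y x))"
    proof (rule Bochner_Integration.integrable_bound[where f="\<lambda>y. \<rho> y * e"])
      show "AE y in lborel. norm (LINT x|lborel. norm (case (y, x) of (y, x) \<Rightarrow> k y x)) \<le> norm (\<rho> y * e)"
        using kle k0 by (auto intro: order.trans[OF _ abs_ge_self])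
      show "integrable lborel (\<lambda>y. \<rho> y * e)" using \<rho>(1) by simp
      have "(\<lambda>y. LINT x|lborel. k y x) \<in> borel_measurable lborel" by measurable
      then show "(\<lambda>y. LINT x|lborel. norm (case (y, x) of (y, x) \<Rightarrow> k y x)) \<in> borel_measurable lborel"
        using k0 by simp
    qed
    show "AE y in lborel. integrable lborel (\<lambda>x. case (y, x) of (y, x) \<Rightarrow> k y x)"
      using fy f by (auto simp: k_def)
  qed measurable
  have "norm (convolve \<rho> f x - f x) \<le> (LINT y|lborel. k y x)" for x
  proof -
    have i: "integrable lborel (\<lambda>y. \<rho> y *\<^sub>R f (x - y))" "integrable lborel (\<lambda>y. \<rho> y *\<^sub>R f x)"
      using \<rho> bnd fx by (auto intro!: integrable_bounded_scaleR[where B=B])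
    have "convolve \<rho> f x - f x = (LINT y|lborel. \<rho> y *\<^sub>R f (x - y)) - (LINT y|lborel. \<rho> y *\<^sub>R f x)"
      using \<rho> by (simp add: convolve_reflect)
    also have "\<dots> = (LINT y|lborel. \<rho> y *\<^sub>R (f (x - y) - f x))"
      using i by (simp add: scaleR_diff_right)
    also have "norm \<dots> \<le> (LINT y|lborel. norm (\<rho> y *\<^sub>R (f (x - y) - f x)))"
      by (rule integral_norm_bound)
    finally show ?thesis using \<rho>(2) by (simp add: k_def)
  qed
  then have "(LINT x|lborel. norm (convolve \<rho> f x - f x)) \<le> (LINT x|lborel. LINT y|lborel. k y x)"
    using convolve_integrable[OF \<rho>(1) f] f lborel_pair.integrable_snd[OF I]
    by (intro integral_mono) auto
  also have "\<dots> = (LINT y|lborel. LINT x|lborel. k y x)"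
    by (rule lborel_pair.Fubini_integral[OF I])
  also have "\<dots> \<le> (LINT y|lborel. \<rho> y * e)"
    using lborel_pair.integrable_fst[OF I] \<rho> kle by (intro integral_mono) auto
  also have "\<dots> = e" using \<rho> by simp
  finally show ?thesis .
qed

definition mollifier :: "nat \<Rightarrow> 'a::euclidean_space \<Rightarrow> real" where
  "mollifier n x = bump (inverse (Suc n)) x / (LINT x|lborel. bump (inverse (Suc n)) (x::'a))"

text \<open>
  A continuous nonnegative function with vanishing integral is zero almost everywhere, hence
  everywhere, but the bump is \<open>1\<close> at the origin.
\<close>

lemma bump_integral_pos: "r > 0 \<Longrightarrow> (LINT x|lborel. bump r (x::'a::euclidean_space)) > 0"
proof -
  assume r: "r > 0"
  have c: "continuous_on UNIV (bump r :: 'a \<Rightarrow> real)" and i: "integrable lborel (bump r :: 'a \<Rightarrow> real)"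
    using bump_test_function[OF r] by (auto intro: test_function_continuous_on test_function_integrable)
  have "(LINT x|lborel. bump r (x::'a)) \<noteq> 0"
  proof
    assume "(LINT x|lborel. bump r (x::'a)) = 0"
    then have "AE x in lborel. bump r (x::'a) = 0"
      using integral_nonneg_eq_0_iff_AE[OF i] bump_bounds(1) by auto
    moreover have op: "open {x::'a. bump r x \<noteq> 0}"
      by (intro open_Collect_neq c continuous_on_const)
    moreover from this have "{x::'a. bump r x \<noteq> 0} \<in> sets lborel" by simp
    ultimately have "{x::'a. bump r x \<noteq> 0} \<in> null_sets lborel" by (simp add: AE_iff_null)
    then have "negligible {x::'a. bump r x \<noteq> 0}"
      using null_sets_completionI negligible_iff_null_sets by blast
    with op have "{x::'a. bump r x \<noteq> 0} = {}" using open_not_negligible by blast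
    then show False using bump_bounds(3)[of r] by (metis (mono_tags, lifting) empty_iff mem_Collect_eq zero_neq_one)
  qed
  moreover have "(LINT x|lborel. bump r (x::'a)) \<ge> 0"
    by (intro Bochner_Integration.integral_nonneg bump_bounds)
  ultimately show ?thesis by simp
qed

lemma mollifier_test_function: "test_function (mollifier n)"
  using test_function_mult[OF bump_test_function C_k_const, of "inverse (Suc n)" "inverse (LINT x|lborel. bump (inverse (Suc n)) (x::'a))"]
  by (simp add: mollifier_def[abs_def] divide_inverse)

lemma mollifier_nonneg: "mollifier n (x::'a::euclidean_space) \<ge> 0"
  unfolding mollifier_def
  by (intro divide_nonneg_nonneg bump_bounds Bochner_Integration.integral_nonneg)

lemma mollifier_integral: "(LINT x|lborel. mollifier n (x::'a::euclidean_space)) = 1"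
  using bump_integral_pos[of "inverse (Suc n)", where 'a='a] by (simp add: mollifier_def)

lemma mollifier_support: "norm x \<ge> inverse (Suc n) \<Longrightarrow> mollifier n x = 0"
  using bump_support[of "inverse (Suc n)" x] by (simp add: mollifier_def)

lemma mollifier_tendsto_L1:
  fixes f :: "'a::euclidean_space \<Rightarrow> 'b::euclidean_space"
  assumes f: "integrable lborel f"
  shows "(\<lambda>n. LINT x|lborel. norm (convolve (mollifier n) f x - f x)) \<longlonglongrightarrow> 0"
proof (rule LIMSEQ_I)
  fix e :: real assume "e > 0"
  let ?\<omega> = "\<lambda>y. LINT x|lborel. norm (f (x - y) - f x)"
  have "((\<lambda>y. ?\<omega> y) \<longlongrightarrow> 0) (nhds 0)"
    using translation_continuous_L1[OF f]
    by (auto simp: tendsto_nhds_iff tendsto_at_iff_sequentially comp_def)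
  then have "eventually (\<lambda>y. ?\<omega> y < e / 2) (nhds 0)"
    using \<open>e > 0\<close> by (intro order_tendstoD(2)) auto
  then obtain d where d: "d > 0" "\<And>y. norm y < d \<Longrightarrow> ?\<omega> y < e / 2"
    by (auto simp: eventually_nhds_metric)
  obtain N where N: "inverse (Suc N) < d" using reals_Archimedean[OF d(1)] by auto
  have "(LINT x|lborel. norm (convolve (mollifier n) f x - f x)) \<le> e / 2" if "n \<ge> N" for n
  proof -
    obtain B where B: "\<And>y. \<bar>mollifier n (y::'a)\<bar> \<le> B"
      using test_function_bounded[OF mollifier_test_function] by metis
    show ?thesis
    proof (rule convolve_L1_dist_le[OF test_function_integrable[OF mollifier_test_function] mollifier_nonneg mollifier_integral f])
      fix y :: 'a
      show "mollifier n y \<le> B" using B[of y] by linarith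
      assume "mollifier n y \<noteq> 0"
      then have "norm y < inverse (Suc n)" using mollifier_support[of n y] by force
      also have "\<dots> \<le> inverse (Suc N)" using that by simp
      finally show "?\<omega> y \<le> e / 2" using d(2)[of y] N by force
    qed
  qed
  then show "\<exists>N. \<forall>n\<ge>N. norm ((LINT x|lborel. norm (convolve (mollifier n) f x - f x)) - 0) < e"
    using \<open>e > 0\<close> by (intro exI[of _ N]) force
qed


section \<open>Mollification of weak gradients\<close>

text \<open>
  Dominated convergence where the dominating functions vary but converge in \<open>L\<^sup>1\<close>. The part of
  \<open>\<bar>F\<^sub>n - f\<bar>\<close> that exceeds \<open>\<bar>g\<^sub>n - g'\<bar>\<close> is at most \<open>2g'\<close>, so the ordinary theorem applies to it.
\<close>

lemma dominated_convergence_L1: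
  fixes F :: "nat \<Rightarrow> 'a \<Rightarrow> real"
  assumes [measurable]: "\<And>n. F n \<in> borel_measurable M" "f \<in> borel_measurable M"
    and conv: "AE x in M. (\<lambda>n. F n x) \<longlonglongrightarrow> f x"
    and g: "\<And>n. integrable M (g n)" "integrable M g'"
    and le: "\<And>n. AE x in M. \<bar>F n x\<bar> \<le> g n x" "AE x in M. \<bar>f x\<bar> \<le> g' x"
    and L1: "(\<lambda>n. LINT x|M. \<bar>g n x - g' x\<bar>) \<longlonglongrightarrow> 0"
  shows "(\<lambda>n. LINT x|M. F n x) \<longlonglongrightarrow> (LINT x|M. f x)"
proof -
  have [measurable]: "g n \<in> borel_measurable M" "g' \<in> borel_measurable M" for n using g by auto
  have iF: "integrable M (F n)" for n
    using le(1)[of n] by (intro Bochner_Integration.integrable_bound[OF g(1)[of n]]) auto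
  have "integrable M f"
    using le(2) by (intro Bochner_Integration.integrable_bound[OF g(2)]) auto
  define m where "m n x = max 0 (\<bar>F n x - f x\<bar> - \<bar>g n x - g' x\<bar>)" for n x
  have [measurable]: "m n \<in> borel_measurable M" for n unfolding m_def by measurable
  have mle: "AE x in M. norm (m n x) \<le> 2 * g' x" for n
    using le(1)[of n] le(2) by eventually_elim (auto simp: m_def)
  have im: "integrable M (m n)" for n
  proof (rule Bochner_Integration.integrable_bound)
    show "integrable M (\<lambda>x. 2 * g' x)" using g(2) by simp
    show "AE x in M. norm (m n x) \<le> norm (2 * g' x)"
      using mle[of n] by eventually_elim (metis abs_ge_self order.trans real_norm_def)
  qed measurable
  have "(\<lambda>n. LINT x|M. m n x) \<longlonglongrightarrow> (LINT x|M. 0)"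
  proof (rule integral_dominated_convergence[OF _ _ _ _ mle])
    show "AE x in M. (\<lambda>n. m n x) \<longlonglongrightarrow> 0"
      using conv
    proof eventually_elim
      fix x assume "(\<lambda>n. F n x) \<longlonglongrightarrow> f x"
      then have "(\<lambda>n. \<bar>F n x - f x\<bar>) \<longlonglongrightarrow> 0" by (simp add: LIM_zero tendsto_rabs_zero)
      then show "(\<lambda>n. m n x) \<longlonglongrightarrow> 0"
        by (rule tendsto_sandwich[OF _ _ tendsto_const, rotated 2]) (auto simp: m_def)
    qed
  qed (use g in auto)
  then have lim: "(\<lambda>n. (LINT x|M. m n x) + (LINT x|M. \<bar>g n x - g' x\<bar>)) \<longlonglongrightarrow> 0"
    using tendsto_add[OF _ L1] by fastforce
  have "norm ((LINT x|M. F n x) - (LINT x|M. f x)) \<le> (LINT x|M. m n x) + (LINT x|M. \<bar>g n x - g' x\<bar>)" for n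
  proof -
    have "norm ((LINT x|M. F n x) - (LINT x|M. f x)) = norm (LINT x|M. F n x - f x)"
      using iF \<open>integrable M f\<close> by simp
    also have "\<dots> \<le> (LINT x|M. m n x + \<bar>g n x - g' x\<bar>)"
    proof (rule order.trans[OF integral_norm_bound integral_mono])
      show "norm (F n x - f x) \<le> m n x + \<bar>g n x - g' x\<bar>" for x by (auto simp: m_def)
    qed (use iF \<open>integrable M f\<close> im g in simp_all)
    also have "\<dots> = (LINT x|M. m n x) + (LINT x|M. \<bar>g n x - g' x\<bar>)"
      using im g by simp
    finally show ?thesis .
  qed
  then have "(\<lambda>n. (LINT x|M. F n x) - (LINT x|M. f x)) \<longlonglongrightarrow> 0"
    by (rule Lim_null_comparison[OF always_eventually[OF allI] lim])
  then show ?thesis by (simp add: LIM_zero_iff)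
qed

lemma C_k_affine:
  "C_k k f \<Longrightarrow> C_k k (\<lambda>x. f (a + c *\<^sub>R x))"
proof (induction k arbitrary: f)
  case 0
  then show ?case by (auto intro!: continuous_on_compose2[of UNIV f] continuous_intros)
next
  case (Suc k)
  have f: "(f has_derivative frechet_derivative f (at x)) (at x)" for x
    using Suc.prems by (intro has_derivative_frechet) simp
  have "((\<lambda>x. f (a + c *\<^sub>R x)) has_derivative (\<lambda>h. frechet_derivative f (at (a + c *\<^sub>R x)) (c *\<^sub>R h))) (at x)" for x
    by (rule has_derivative_compose[OF _ f]) (auto intro!: derivative_eq_intros)
  moreover have "frechet_derivative f (at x) (c *\<^sub>R h) = c * frechet_derivative f (at x) h" for x h
    using has_derivative_linear[OF f] by (simp add: linear_scale)
  moreover have "C_k k (\<lambda>x. c * frechet_derivative f (at (a + c *\<^sub>R x)) i)" if "i \<in> Basis" for i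
    using Suc.prems that Suc.IH[of "\<lambda>x. frechet_derivative f (at x) i"] by (intro C_k_cmult) simp
  ultimately show ?case
    by (intro C_k_SucI[where D="\<lambda>x h. c * frechet_derivative f (at (a + c *\<^sub>R x)) h"]) simp_all
qed

lemma test_function_affine:
  fixes f :: "'a::euclidean_space \<Rightarrow> real"
  assumes "test_function f" "c \<noteq> 0"
  shows "test_function (\<lambda>x. f (a + c *\<^sub>R x))"
proof -
  obtain r where r: "\<And>x. norm x \<ge> r \<Longrightarrow> f x = 0" using test_function_bounded_support[OF assms(1)] by auto
  show ?thesis
  proof (rule test_functionI[where K="cball 0 ((r + norm a) / \<bar>c\<bar>)"])
    show "C_k k (\<lambda>x. f (a + c *\<^sub>R x))" for k
      using C_k_affine test_function_C_k[OF assms(1)] by blast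
    fix x :: 'a assume "x \<notin> cball 0 ((r + norm a) / \<bar>c\<bar>)"
    then have "r + norm a < norm (c *\<^sub>R x)" using assms(2) by (simp add: field_simps)
    also have "\<dots> \<le> norm (a + c *\<^sub>R x) + norm a"
      using norm_triangle_ineq4[of "a + c *\<^sub>R x" a] by simp
    finally show "f (a + c *\<^sub>R x) = 0" by (intro r) simp
  qed simp
qed

lemma grad_affine:
  fixes f :: "'a::euclidean_space \<Rightarrow> real"
  assumes "test_function f"
  shows "grad (\<lambda>x. f (a + c *\<^sub>R x)) x = c *\<^sub>R grad f (a + c *\<^sub>R x)"
proof (rule grad_eqI)
  have "((\<lambda>x. f (a + c *\<^sub>R x)) has_derivative (\<lambda>h. grad f (a + c *\<^sub>R x) \<bullet> (c *\<^sub>R h))) (at x)"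
    by (rule has_derivative_compose[OF _ test_function_grad[OF assms]]) (auto intro!: derivative_eq_intros)
  moreover have "(\<bullet>) (c *\<^sub>R g) = (\<lambda>h. g \<bullet> (c *\<^sub>R h))" for g :: 'a by (simp add: fun_eq_iff)
  ultimately show "((\<lambda>x. f (a + c *\<^sub>R x)) has_derivative (\<bullet>) (c *\<^sub>R grad f (a + c *\<^sub>R x))) (at x)"
    by metis
qed

text \<open>
  The derivative of \<open>\<rho> * u\<close> falls on \<open>\<rho>\<close>, and the definition of the weak gradient with the test
  function \<open>y \<mapsto> \<rho>(x - y)\<close> moves it to \<open>u\<close>.
\<close>

lemma grad_convolve_weak_gradient:
  assumes \<rho>: "test_function \<rho>" and u: "integrable lborel u" and G: "weak_gradient u G"
  shows "grad (convolve \<rho> u) x = convolve \<rho> G x"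
proof -
  have t: "test_function (\<lambda>y. \<rho> (x - y))"
    using test_function_affine[OF \<rho>, of "- 1" x] by simp
  have g: "grad (\<lambda>y. \<rho> (x - y)) y = - grad \<rho> (x - y)" for y
    using grad_affine[OF \<rho>, of x "- 1" y] by simp
  have "grad (convolve \<rho> u) x = (LINT y|lborel. u y *\<^sub>R grad \<rho> (x - y))"
    by (rule grad_eqI[OF convolve_has_derivative[OF \<rho> u]])
  also have "\<dots> = - (LINT y|lborel. u y *\<^sub>R grad (\<lambda>y. \<rho> (x - y)) y)"
    by (simp add: g)
  also have "\<dots> = convolve \<rho> G x"
    using G t by (simp add: weak_gradient_def convolve_def)
  finally show ?thesis .
qed


section \<open>Nonlinear test functions in the weak equation\<close>

text \<open>
  The left hand side is at most the \<open>p\<close>-th power of the larger of the two numbers.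
\<close>

lemma powr_young:
  fixes a b p :: real
  assumes "a \<ge> 0" "b \<ge> 0" "p > 1"
  shows "a powr (p - 1) * b \<le> a powr p + b powr p"
proof -
  have e: "c powr (p - 1) * c = c powr p" if "c \<ge> 0" for c
    using that by (cases "c = 0") (simp_all add: powr_diff)
  show ?thesis
  proof (cases "b \<le> a")
    case True
    then have "a powr (p - 1) * b \<le> a powr (p - 1) * a" by (intro mult_left_mono) auto
    also have "\<dots> = a powr p" using e assms by simp
    finally show ?thesis using powr_ge_zero[of b p] by linarith
  next
    case False
    then have "a powr (p - 1) * b \<le> b powr (p - 1) * b"
      using assms by (intro mult_right_mono powr_mono2) auto
    also have "\<dots> = b powr p" using e assms by simp
    finally show ?thesis using powr_ge_zero[of a p] by linarith
  qed
qed

text \<open>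
  The unweighted inequality for \<open>a\<close> and \<open>b / s\<close>, multiplied by \<open>s\<close>.
\<close>

lemma powr_young_weighted:
  fixes a b p s :: real
  assumes "a \<ge> 0" "b \<ge> 0" "p > 1" "s > 0"
  shows "a powr (p - 1) * b \<le> s * a powr p + s powr (1 - p) * b powr p"
proof -
  have "a powr (p - 1) * b = s * (a powr (p - 1) * (b / s))" using assms by simp
  also have "\<dots> \<le> s * (a powr p + (b / s) powr p)"
    using assms by (intro mult_left_mono powr_young) auto
  also have "\<dots> = s * a powr p + s powr (1 - p) * b powr p"
    using assms by (simp add: powr_divide powr_diff algebra_simps)
  finally show ?thesis .
qed

definition flux :: "real \<Rightarrow> 'a::euclidean_space \<Rightarrow> 'a" where
  "flux p z = norm z powr (p - 2) *\<^sub>R z"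

lemma norm_flux: "norm (flux p z) = norm z powr (p - 1)"
proof -
  have "norm (flux p z) = norm z * norm z powr (p - 2)" by (simp add: flux_def)
  also have "\<dots> = norm z powr (p - 1)" by (subst powr_mult_base) simp_all
  finally show ?thesis .
qed

lemma flux_inner: "flux p z \<bullet> z = norm z powr p"
proof -
  have "flux p z \<bullet> z = norm z * (norm z * norm z powr (p - 2))"
    by (simp add: flux_def dot_square_norm power2_eq_square)
  also have "\<dots> = norm z powr p"
    using powr_mult_base[of "norm z" "p - 2"] powr_mult_base[of "norm z" "p - 1"] by simp
  finally show ?thesis .
qed

lemma flux_measurable[measurable]: "flux p \<in> borel_measurable borel"
  unfolding flux_def by measurable

lemma powr_pred_le: "1 < p \<Longrightarrow> 0 \<le> (a::real) \<Longrightarrow> a powr (p - 1) \<le> 1 + a powr p"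
  using powr_young[of a 1 p] by simp

lemma integrable_flux_inner:
  fixes G g :: "'a::euclidean_space \<Rightarrow> 'a"
  assumes "p > 1" and [measurable]: "G \<in> borel_measurable borel"
    and Gp: "integrable lborel (\<lambda>x. norm (G x) powr p)"
    and g: "continuous_on UNIV g" "\<And>x. norm x \<ge> R \<Longrightarrow> g x = 0"
    and [measurable]: "w \<in> borel_measurable borel" and w: "\<And>x. \<bar>w x\<bar> \<le> C"
  shows "integrable lborel (\<lambda>x. w x * (norm (G x) powr (p - 1) * norm (g x)))"
    and "integrable lborel (\<lambda>x. w x * (flux p (G x) \<bullet> g x))"
proof -
  have [measurable]: "g \<in> borel_measurable borel" by (rule borel_measurable_continuous_onI) fact
  obtain B where B: "B > 0" "\<And>x. norm (g x) \<le> B" using bounded_support_bounded[OF g] by metis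
  have "integrable lborel g" by (rule integrable_bounded_support[OF g])
  then have i: "integrable lborel (\<lambda>x. C * (norm (g x) + B * norm (G x) powr p))"
    using Gp by simp
  have C: "C \<ge> 0" using w[of undefined] by linarith
  have le: "\<bar>w x\<bar> * (norm (G x) powr (p - 1) * norm (g x)) \<le> C * (norm (g x) + B * norm (G x) powr p)" for x
  proof (rule mult_mono[OF w _ C])
    have "norm (G x) powr (p - 1) * norm (g x) \<le> (1 + norm (G x) powr p) * norm (g x)"
      using powr_pred_le[OF assms(1), of "norm (G x)"] by (intro mult_right_mono) auto
    also have "\<dots> \<le> norm (g x) + B * norm (G x) powr p"
      using mult_left_mono[OF B(2)[of x], of "norm (G x) powr p"] by (simp add: algebra_simps)
    finally show "norm (G x) powr (p - 1) * norm (g x) \<le> norm (g x) + B * norm (G x) powr p" .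
  qed simp
  have le': "\<bar>w x\<bar> * \<bar>flux p (G x) \<bullet> g x\<bar> \<le> C * (norm (g x) + B * norm (G x) powr p)" for x
    by (rule order.trans[OF mult_left_mono le])
      (use Cauchy_Schwarz_ineq2[of "flux p (G x)" "g x"] in \<open>auto simp: norm_flux\<close>)
  have dom: "integrable lborel f"
    if [measurable]: "f \<in> borel_measurable borel"
      and f: "\<And>x. \<bar>f x\<bar> \<le> C * (norm (g x) + B * norm (G x) powr p)" for f :: "'a \<Rightarrow> real"
  proof (rule Bochner_Integration.integrable_bound[OF i])
    have "norm (f x) \<le> norm (C * (norm (g x) + B * norm (G x) powr p))" for x
      using f[of x] by (metis abs_ge_self order.trans real_norm_def)
    then show "AE x in lborel. norm (f x) \<le> norm (C * (norm (g x) + B * norm (G x) powr p))" by simp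
  qed simp
  show "integrable lborel (\<lambda>x. w x * (norm (G x) powr (p - 1) * norm (g x)))"
    by (rule dom, measurable) (use le in \<open>simp add: abs_mult\<close>)
  show "integrable lborel (\<lambda>x. w x * (flux p (G x) \<bullet> g x))"
    by (rule dom, measurable) (use le' in \<open>simp add: abs_mult\<close>)
qed

text \<open>
  Young's inequality under the convolution integral. This dominates the product of the flux and a
  mollified gradient by functions that converge in \<open>L\<^sup>1\<close>. If
  \<open>G\<close> is not integrable against \<open>\<rho>(x - \<sqdot>)\<close>, the convolution is \<open>0\<close> by convention and the
  inequality holds trivially.
\<close>

lemma norm_flux_convolve_le:
  fixes G :: "'a::euclidean_space \<Rightarrow> 'a"
  assumes p: "p > 1" and [measurable]: "G \<in> borel_measurable borel"
    and Gp: "integrable lborel (\<lambda>x. norm (G x) powr p)"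
    and \<rho>: "test_function \<rho>" "\<And>y. \<rho> y \<ge> 0" "(LINT y|lborel. \<rho> y) = 1"
  shows "norm (flux p z) * norm (convolve \<rho> G x) \<le> norm z powr p + convolve \<rho> (\<lambda>y. norm (G y) powr p) x"
proof -
  note [measurable] = test_function_measurable[OF \<rho>(1)]
  obtain B where B: "\<And>y. \<bar>\<rho> y\<bar> \<le> B" using test_function_bounded[OF \<rho>(1)] by metis
  have i\<rho>: "integrable lborel (\<lambda>y. \<rho> (x - y))"
    using test_function_integrable[OF \<rho>(1)] by (simp add: integrable_lborel_reflect)
  have \<rho>1: "(LINT y|lborel. \<rho> (x - y)) = 1"
    using \<rho>(3) integral_lborel_reflect[of \<rho> x] by simp
  have ip: "integrable lborel (\<lambda>y. \<rho> (x - y) * norm (G y) powr p)"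
    using integrable_bounded_scaleR[OF Gp, of "\<lambda>y. \<rho> (x - y)" B] B by simp
  have cp: "convolve \<rho> (\<lambda>y. norm (G y) powr p) x \<ge> 0"
    using \<rho>(2) by (simp add: convolve_def)
  show ?thesis
  proof (cases "integrable lborel (\<lambda>y. \<rho> (x - y) *\<^sub>R G y)")
    case False
    then show ?thesis using cp by (simp add: convolve_def not_integrable_integral_eq)
  next
    case True
    have "norm (flux p z) * norm (convolve \<rho> G x) \<le> norm (flux p z) * (LINT y|lborel. norm (\<rho> (x - y) *\<^sub>R G y))"
      unfolding convolve_def by (intro mult_left_mono integral_norm_bound) auto
    also have "\<dots> = (LINT y|lborel. norm (flux p z) * norm (\<rho> (x - y) *\<^sub>R G y))"
      by simp
    also have "\<dots> \<le> (LINT y|lborel. \<rho> (x - y) * norm z powr p + \<rho> (x - y) * norm (G y) powr p)"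
    proof (rule integral_mono)
      show "integrable lborel (\<lambda>y. norm (flux p z) * norm (\<rho> (x - y) *\<^sub>R G y))"
        by (intro integrable_mult_right integrable_norm True)
      show "integrable lborel (\<lambda>y. \<rho> (x - y) * norm z powr p + \<rho> (x - y) * norm (G y) powr p)"
        using i\<rho> ip by simp
      fix y
      have "\<rho> (x - y) * (norm z powr (p - 1) * norm (G y)) \<le> \<rho> (x - y) * (norm z powr p + norm (G y) powr p)"
        using \<rho>(2) p by (intro mult_left_mono powr_young) auto
      then show "norm (flux p z) * norm (\<rho> (x - y) *\<^sub>R G y) \<le> \<rho> (x - y) * norm z powr p + \<rho> (x - y) * norm (G y) powr p"
        using \<rho>(2) by (simp add: norm_flux algebra_simps)
    qed
    also have "\<dots> = norm z powr p + convolve \<rho> (\<lambda>y. norm (G y) powr p) x"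
      using i\<rho> ip \<rho>1 by (simp add: convolve_def)
    finally show ?thesis .
  qed
qed

text \<open>
  Since the gradient is only locally integrable, it is truncated to a larger ball. Inside the
  smaller ball this does not affect its mollifications, as the mollifiers are supported in the unit
  ball.
\<close>

lemma AE_convergent_mollification:
  assumes "integrable lborel (u::'a::euclidean_space \<Rightarrow> real)" and G: "locally_integrable (G::'a \<Rightarrow> 'a)"
  shows "\<exists>r. strict_mono r \<and> (AE x in lborel. (\<lambda>n. convolve (mollifier (r n)) u x) \<longlonglongrightarrow> u x)
    \<and> (AE x in lborel. norm x < R \<longrightarrow> (\<lambda>n. convolve (mollifier (r n)) G x) \<longlonglongrightarrow> G x)"
proof -
  let ?G = "\<lambda>x. indicator (cball 0 (R + 1)) x *\<^sub>R G x"
  have iG: "integrable lborel ?G"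
    using G by (simp add: locally_integrable_def set_integrable_def)
  have 1: "integrable lborel (\<lambda>x. convolve (mollifier n) f x - f x)"
    if "integrable lborel (f::'a \<Rightarrow> 'b::euclidean_space)" for n f
    using that convolve_integrable[OF test_function_integrable[OF mollifier_test_function] that]
    by (intro Bochner_Integration.integrable_diff)
  obtain r where r: "strict_mono r" "AE x in lborel. (\<lambda>n. convolve (mollifier (r n)) u x - u x) \<longlonglongrightarrow> 0"
    using tendsto_L1_AE_subseq[OF 1[OF assms(1)] mollifier_tendsto_L1[OF assms(1)]] by auto
  have "(\<lambda>n. LINT x|lborel. norm (convolve (mollifier (r n)) ?G x - ?G x)) \<longlonglongrightarrow> 0"
    using LIMSEQ_subseq_LIMSEQ[OF mollifier_tendsto_L1[OF iG] r(1)] by (simp add: comp_def)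
  from tendsto_L1_AE_subseq[OF 1[OF iG] this]
  obtain s where s: "strict_mono s" "AE x in lborel. (\<lambda>n. convolve (mollifier (r (s n))) ?G x - ?G x) \<longlonglongrightarrow> 0"
    by auto
  \<comment> \<open>The truncation is invisible at points of the smaller ball.\<close>
  have loc: "convolve (mollifier n) ?G x = convolve (mollifier n) G x" if "norm x < R" for n x
  proof -
    have "mollifier n (x - y) *\<^sub>R ?G y = mollifier n (x - y) *\<^sub>R G y" for y
    proof (cases "norm (x - y) \<ge> inverse (Suc n)")
      case True
      then show ?thesis using mollifier_support[of n "x - y"] by simp
    next
      case False
      then have "norm (x - y) < 1" using inverse_le_1_iff[of "real (Suc n)"] by linarith
      then have "norm y \<le> R + 1" using that norm_triangle_ineq2[of y x] by (simp add: norm_minus_commute)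
      then show ?thesis by simp
    qed
    then show ?thesis unfolding convolve_def by presburger
  qed
  show ?thesis
  proof (intro exI[of _ "r \<circ> s"] conjI)
    show "strict_mono (r \<circ> s)" using r s by (simp add: strict_mono_o)
    show "AE x in lborel. (\<lambda>n. convolve (mollifier ((r \<circ> s) n)) u x) \<longlonglongrightarrow> u x"
      using r(2)
    proof eventually_elim
      case (elim x)
      then have "(\<lambda>n. convolve (mollifier (r n)) u x) \<longlonglongrightarrow> u x" by (simp add: LIM_zero_iff)
      from LIMSEQ_subseq_LIMSEQ[OF this s(1)] show ?case by (simp add: comp_def)
    qed
    show "AE x in lborel. norm x < R \<longrightarrow> (\<lambda>n. convolve (mollifier ((r \<circ> s) n)) G x) \<longlonglongrightarrow> G x"
      using s(2)
    proof eventually_elim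
      case (elim x)
      then have "(\<lambda>n. convolve (mollifier (r (s n))) ?G x) \<longlonglongrightarrow> ?G x" by (simp add: LIM_zero_iff)
      then show ?case by (auto simp: loc)
    qed
  qed
qed

text \<open>
  The weak equation may be tested with \<open>H(u) \<eta>\<close>, with the gradient given by the chain rule. This is
  the limit of the equation for the genuine test functions \<open>H(\<rho>\<^sub>n * u) \<eta>\<close>.
\<close>

lemma weak_equation_composite_test:
  fixes u v :: "'a::euclidean_space \<Rightarrow> real" and G :: "'a \<Rightarrow> 'a"
  assumes p: "1 < p" and u: "integrable lborel u" and wG: "weak_gradient u G"
    and [measurable]: "G \<in> borel_measurable borel"
    and Gp: "integrable lborel (\<lambda>x. norm (G x) powr p)"
    and v: "integrable lborel v"
    and eq: "\<And>\<phi>. test_function \<phi> \<Longrightarrow>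
        (LINT x|lborel. flux p (G x) \<bullet> grad \<phi> x) = (LINT x|lborel. v x * \<phi> x)"
    and \<eta>: "test_function \<eta>"
    and H: "\<And>s. (H has_real_derivative h s) (at s)" "\<And>s. \<bar>H s\<bar> \<le> C"
    and h: "continuous_on UNIV h" "\<And>s. \<bar>h s\<bar> \<le> B"
    and smooth: "\<And>q k. (\<And>k. C_k k q) \<Longrightarrow> C_k k (\<lambda>x::'a. H (q x))"
  shows "(LINT x|lborel. norm (G x) powr p * (h (u x) * \<eta> x))
      + (LINT x|lborel. H (u x) * (flux p (G x) \<bullet> grad \<eta> x))
      = (LINT x|lborel. v x * (H (u x) * \<eta> x))"
proof -
  have [measurable]: "u \<in> borel_measurable borel" "v \<in> borel_measurable borel"
    using u v by auto
  note [measurable] = test_function_measurable[OF \<eta>] test_function_grad_measurable[OF \<eta>]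
  have contH: "continuous_on UNIV H"
    using H(1) by (meson DERIV_isCont continuous_at_imp_continuous_on)
  have [measurable]: "H \<in> borel_measurable borel" "h \<in> borel_measurable borel"
    using contH h(1) by (auto intro: borel_measurable_continuous_onI)
  have C0: "C \<ge> 0" and B0: "B \<ge> 0" using H(2)[of 0] h(2)[of 0] by linarith+
  obtain R1 where R1: "\<And>x. norm x \<ge> R1 \<Longrightarrow> \<eta> x = 0" using test_function_bounded_support[OF \<eta>] by auto
  obtain R2 where R2: "\<And>x. norm x \<ge> R2 \<Longrightarrow> grad \<eta> x = 0" using test_function_grad_bounded_support[OF \<eta>] by auto
  obtain K where K: "K > 0" "\<And>x. \<bar>\<eta> x\<bar> \<le> K" using test_function_bounded[OF \<eta>] by metis
  obtain r where "strict_mono r"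
    and ru: "AE x in lborel. (\<lambda>n. convolve (mollifier (r n)) u x) \<longlonglongrightarrow> u x"
    and rG: "AE x in lborel. norm x < R1 \<longrightarrow> (\<lambda>n. convolve (mollifier (r n)) G x) \<longlonglongrightarrow> G x"
    using AE_convergent_mollification[OF u, of G R1] wG by (auto simp: weak_gradient_def)
  define un where "un n = convolve (mollifier (r n)) u" for n
  define Gn where "Gn n = convolve (mollifier (r n)) G" for n
  define gp where "gp n = convolve (mollifier (r n)) (\<lambda>x. norm (G x) powr p)" for n
  have un_smooth: "C_k k (un n)" for k n
    unfolding un_def by (rule convolve_C_k[OF mollifier_test_function u])
  have [measurable]: "un n \<in> borel_measurable borel" for n
    using C_k_continuous_on[OF un_smooth[of 0 n]] by (rule borel_measurable_continuous_onI)
  have un_der: "(un n has_derivative (\<lambda>y. Gn n x \<bullet> y)) (at x)" for n x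
    using has_derivative_grad[of "un n" x] un_smooth[of 1 n]
      grad_convolve_weak_gradient[OF mollifier_test_function u wG, of "r n" x]
    by (auto simp: un_def Gn_def differentiable_on_def)
  have [measurable]: "Gn n \<in> borel_measurable borel" for n
    unfolding Gn_def convolve_def[abs_def] using test_function_measurable[OF mollifier_test_function]
    by measurable
  define \<psi> where "\<psi> n x = \<eta> x * H (un n x)" for n x
  have \<psi>: "test_function (\<psi> n)" for n
    unfolding \<psi>_def[abs_def] by (rule test_function_mult[OF \<eta> smooth[OF un_smooth]])
  have grad\<psi>: "grad (\<psi> n) x = (h (un n x) * \<eta> x) *\<^sub>R Gn n x + H (un n x) *\<^sub>R grad \<eta> x" for n x
  proof (rule grad_eqI)
    have "((\<lambda>x. H (un n x)) has_derivative (\<lambda>y. h (un n x) * (Gn n x \<bullet> y))) (at x)"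
      using has_derivative_compose[OF un_der, of H "(*) (h (un n x))"] H(1)[of "un n x"]
      by (simp add: has_field_derivative_def)
    from has_derivative_mult[OF test_function_grad[OF \<eta>] this]
    show "(\<psi> n has_derivative (\<bullet>) ((h (un n x) * \<eta> x) *\<^sub>R Gn n x + H (un n x) *\<^sub>R grad \<eta> x)) (at x)"
      unfolding \<psi>_def[abs_def] by (rule has_derivative_eq_rhs) (simp add: fun_eq_iff inner_add_left algebra_simps)
  qed
  define F where "F n x = flux p (G x) \<bullet> grad (\<psi> n) x" for n x
  define F' where "F' x = flux p (G x) \<bullet> ((h (u x) * \<eta> x) *\<^sub>R G x + H (u x) *\<^sub>R grad \<eta> x)" for x
  define e where "e x = C * (norm (G x) powr (p - 1) * norm (grad \<eta> x))" for x
  have ie: "integrable lborel e"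
    unfolding e_def using integrable_flux_inner(1)[OF p _ Gp test_function_grad_continuous[OF \<eta>] R2, where w="\<lambda>_. C" and C=C] C0
    by simp
  have igp: "integrable lborel (gp n)" for n
    unfolding gp_def using convolve_integrable[OF test_function_integrable[OF mollifier_test_function] Gp] .
  have norm_inner: "\<bar>flux p y \<bullet> (a *\<^sub>R z + b *\<^sub>R grad \<eta> x)\<bar> \<le> B * K * (norm (flux p y) * norm z) + C * (norm (flux p y) * norm (grad \<eta> x))"
    if "\<bar>a\<bar> \<le> B * K" "\<bar>b\<bar> \<le> C" for y a z b x
  proof -
    have "\<bar>flux p y \<bullet> (a *\<^sub>R z + b *\<^sub>R grad \<eta> x)\<bar> \<le> \<bar>a\<bar> * \<bar>flux p y \<bullet> z\<bar> + \<bar>b\<bar> * \<bar>flux p y \<bullet> grad \<eta> x\<bar>"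
      by (simp add: inner_add_right abs_mult[symmetric] abs_triangle_ineq)
    also have "\<dots> \<le> B * K * (norm (flux p y) * norm z) + C * (norm (flux p y) * norm (grad \<eta> x))"
      using that C0 B0 K(1) by (intro add_mono mult_mono Cauchy_Schwarz_ineq2) auto
    finally show ?thesis .
  qed
  have hK: "\<bar>h s * \<eta> x\<bar> \<le> B * K" for s x
    using h(2) K(2) B0 unfolding abs_mult by (intro mult_mono) auto
  \<comment> \<open>The dominating functions contain the mollifications of \<open>\<bar>G\<bar>\<^sup>p\<close>, which converge in \<open>L\<^sup>1\<close>.\<close>
  have lim1: "(\<lambda>n. LINT x|lborel. F n x) \<longlonglongrightarrow> (LINT x|lborel. F' x)"
  proof (rule dominated_convergence_L1)
    show "F n \<in> borel_measurable lborel" for n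
      unfolding F_def grad\<psi> by measurable
    show "F' \<in> borel_measurable lborel"
      unfolding F'_def by measurable
    show "AE x in lborel. (\<lambda>n. F n x) \<longlonglongrightarrow> F' x"
      using ru rG
    proof eventually_elim
      fix x assume x: "(\<lambda>n. convolve (mollifier (r n)) u x) \<longlonglongrightarrow> u x"
        and xG: "norm x < R1 \<longrightarrow> (\<lambda>n. convolve (mollifier (r n)) G x) \<longlonglongrightarrow> G x"
      have lH: "(\<lambda>n. H (un n x)) \<longlonglongrightarrow> H (u x)" and lh: "(\<lambda>n. h (un n x)) \<longlonglongrightarrow> h (u x)"
        using continuous_on_tendsto_compose[OF contH x] continuous_on_tendsto_compose[OF h(1) x]
        by (simp_all add: un_def)
      have "(\<lambda>n. (h (un n x) * \<eta> x) *\<^sub>R Gn n x) \<longlonglongrightarrow> (h (u x) * \<eta> x) *\<^sub>R G x"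
      proof (cases "norm x < R1")
        case True
        then have "(\<lambda>n. Gn n x) \<longlonglongrightarrow> G x" using xG by (simp add: Gn_def)
        then show ?thesis by (intro tendsto_intros lh)
      qed (use R1 in auto)
      then show "(\<lambda>n. F n x) \<longlonglongrightarrow> F' x"
        unfolding F_def F'_def grad\<psi> 
        by (intro tendsto_inner tendsto_add tendsto_scaleR[OF lH] tendsto_const)
    qed
    show "integrable lborel (\<lambda>x. B * K * (norm (G x) powr p + gp n x) + e x)" for n
      using Gp igp ie by simp
    show "integrable lborel (\<lambda>x. B * K * (norm (G x) powr p + norm (G x) powr p) + e x)"
      using Gp ie by simp
    show "AE x in lborel. \<bar>F n x\<bar> \<le> B * K * (norm (G x) powr p + gp n x) + e x" for n
    proof (rule AE_I2)
      fix x
      have "\<bar>F n x\<bar> \<le> B * K * (norm (flux p (G x)) * norm (Gn n x)) + C * (norm (flux p (G x)) * norm (grad \<eta> x))"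
        unfolding F_def grad\<psi> by (rule norm_inner[OF hK H(2)])
      also have "\<dots> \<le> B * K * (norm (G x) powr p + gp n x) + e x"
        unfolding Gn_def gp_def e_def norm_flux[of p "G x", symmetric] using B0 K(1)
        by (intro add_right_mono mult_left_mono norm_flux_convolve_le[OF p _ Gp mollifier_test_function mollifier_nonneg mollifier_integral])
          auto
      finally show "\<bar>F n x\<bar> \<le> B * K * (norm (G x) powr p + gp n x) + e x" .
    qed
    show "AE x in lborel. \<bar>F' x\<bar> \<le> B * K * (norm (G x) powr p + norm (G x) powr p) + e x"
    proof (rule AE_I2)
      fix x
      have "norm (flux p (G x)) * norm (G x) = norm (G x) powr p"
        by (simp add: norm_flux powr_mult_base mult.commute[of _ "norm (G x)"])
      then have "\<bar>F' x\<bar> \<le> B * K * norm (G x) powr p + e x"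
        using norm_inner[OF hK[of "u x" x] H(2)[of "u x"], of "G x" "G x" x]
        unfolding F'_def e_def norm_flux by simp
      also have "\<dots> \<le> B * K * (norm (G x) powr p + norm (G x) powr p) + e x"
        using B0 K(1) by (intro add_right_mono mult_left_mono) auto
      finally show "\<bar>F' x\<bar> \<le> B * K * (norm (G x) powr p + norm (G x) powr p) + e x" .
    qed
    have "(\<lambda>n. LINT x|lborel. norm (gp n x - norm (G x) powr p)) \<longlonglongrightarrow> 0"
      using LIMSEQ_subseq_LIMSEQ[OF mollifier_tendsto_L1[OF Gp] \<open>strict_mono r\<close>] by (simp add: gp_def comp_def)
    then have "(\<lambda>n. B * K * (LINT x|lborel. norm (gp n x - norm (G x) powr p))) \<longlonglongrightarrow> 0"
      by (rule tendsto_mult_right_zero)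
    moreover have "\<bar>B * K * (norm (G x) powr p + gp n x) + e x - (B * K * (norm (G x) powr p + norm (G x) powr p) + e x)\<bar>
        = B * K * norm (gp n x - norm (G x) powr p)" for n x
    proof -
      have "B * K * (norm (G x) powr p + gp n x) + e x - (B * K * (norm (G x) powr p + norm (G x) powr p) + e x)
        = B * K * (gp n x - norm (G x) powr p)" by (simp add: algebra_simps)
      then show ?thesis using B0 K(1) by (simp add: abs_mult)
    qed
    ultimately show "(\<lambda>n. LINT x|lborel. \<bar>B * K * (norm (G x) powr p + gp n x) + e x - (B * K * (norm (G x) powr p + norm (G x) powr p) + e x)\<bar>) \<longlonglongrightarrow> 0"
      by simp
  qed
  have lim2: "(\<lambda>n. LINT x|lborel. v x * \<psi> n x) \<longlonglongrightarrow> (LINT x|lborel. v x * (H (u x) * \<eta> x))"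
  proof (rule integral_dominated_convergence[where w="\<lambda>x. \<bar>v x\<bar> * (K * C)"])
    show "AE x in lborel. (\<lambda>n. v x * \<psi> n x) \<longlonglongrightarrow> v x * (H (u x) * \<eta> x)"
      using ru
    proof eventually_elim
      fix x assume x: "(\<lambda>n. convolve (mollifier (r n)) u x) \<longlonglongrightarrow> u x"
      have "(\<lambda>n. H (un n x)) \<longlonglongrightarrow> H (u x)"
        using continuous_on_tendsto_compose[OF contH x] by (simp add: un_def)
      then show "(\<lambda>n. v x * \<psi> n x) \<longlonglongrightarrow> v x * (H (u x) * \<eta> x)"
        unfolding \<psi>_def by (subst mult.commute[of "H (u x)"]) (intro tendsto_intros)
    qed
    show "AE x in lborel. norm (v x * \<psi> n x) \<le> \<bar>v x\<bar> * (K * C)" for n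
    proof (rule AE_I2)
      fix x
      have "\<bar>\<psi> n x\<bar> \<le> K * C"
        unfolding \<psi>_def abs_mult using K H(2) by (intro mult_mono) auto
      then show "norm (v x * \<psi> n x) \<le> \<bar>v x\<bar> * (K * C)" by (simp add: abs_mult mult_left_mono)
    qed
  qed (use v test_function_measurable[OF \<psi>] in auto)
  have "(LINT x|lborel. F n x) = (LINT x|lborel. v x * \<psi> n x)" for n
    unfolding F_def by (rule eq[OF \<psi>])
  with lim1 lim2 have "(LINT x|lborel. F' x) = (LINT x|lborel. v x * (H (u x) * \<eta> x))"
    using LIMSEQ_unique by simp
  moreover have "(LINT x|lborel. F' x) = (LINT x|lborel. norm (G x) powr p * (h (u x) * \<eta> x))
      + (LINT x|lborel. H (u x) * (flux p (G x) \<bullet> grad \<eta> x))"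
  proof -
    have "integrable lborel (\<lambda>x. (h (u x) * \<eta> x) *\<^sub>R (norm (G x) powr p))"
      using hK by (intro integrable_bounded_scaleR[OF Gp]) auto
    moreover have "integrable lborel (\<lambda>x. H (u x) * (flux p (G x) \<bullet> grad \<eta> x))"
      using H(2) by (intro integrable_flux_inner(2)[OF p _ Gp test_function_grad_continuous[OF \<eta>] R2]) auto
    ultimately show ?thesis
      unfolding F'_def by (simp add: inner_add_right flux_inner mult.commute)
  qed
  ultimately show ?thesis by simp
qed


section \<open>The flux estimate\<close>

text \<open>
  On the positive half-line the integrand is at most a constant times \<open>(1 + s)\<^sup>-\<^sup>\<theta>\<close>, whose primitive is
  bounded as \<open>\<theta> > 1\<close>. Reflection handles the negative half-line.
\<close>

lemma bounded_antiderivative: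
  fixes \<theta> :: real
  assumes \<theta>: "\<theta> > 1"
  obtains H C where "C > 0" "\<And>s. (H has_real_derivative (1 + s\<^sup>2) powr (- \<theta> / 2)) (at s)" "\<And>s. \<bar>H s\<bar> \<le> C"
proof -
  define h where "h s = (1 + s\<^sup>2) powr (- \<theta> / 2)" for s :: real
  define c where "c = 2 powr (\<theta> / 2) / (\<theta> - 1)"
  have c0: "c > 0" using \<theta> by (simp add: c_def)
  have pos: "1 + s\<^sup>2 > 0" for s :: real by (simp add: add_pos_nonneg)
  have "\<exists>F. \<forall>x. (-\<infinity>::ereal) < ereal x \<longrightarrow> ereal x < \<infinity> \<longrightarrow> (F has_vector_derivative h x) (at x)"
    unfolding h_def using pos by (intro einterval_antiderivative) (auto intro!: continuous_intros simp: less_imp_neq[OF pos, symmetric])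
  then obtain F where F: "\<And>s. (F has_real_derivative h s) (at s)"
    by (auto simp: has_real_derivative_iff_has_vector_derivative)
  \<comment> \<open>From \<open>(1 + s)\<^sup>2 \<le> 2 (1 + s\<^sup>2)\<close>.\<close>
  have hle: "h s \<le> c * (\<theta> - 1) * (1 + s) powr (- \<theta>)" if "s \<ge> 0" for s
  proof -
    have "0 \<le> (1 - s)\<^sup>2" by simp
    then have "(1 + s)\<^sup>2 / 2 \<le> 1 + s\<^sup>2" by (simp add: power2_eq_square algebra_simps)
    then have "h s \<le> ((1 + s)\<^sup>2 / 2) powr (- \<theta> / 2)"
      using \<theta> that unfolding h_def by (intro powr_mono2') auto
    also have "\<dots> = c * (\<theta> - 1) * (1 + s) powr (- \<theta>)"
    proof -
      have "((1 + s)\<^sup>2) powr (- \<theta> / 2) = (1 + s) powr (- \<theta>)"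
        using that by (simp add: powr_powr flip: powr_numeral)
      then show ?thesis
        using \<theta> that by (simp add: c_def powr_divide powr_minus_divide)
    qed
    finally show ?thesis .
  qed
  have key: "0 \<le> G s - G 0 \<and> G s - G 0 \<le> c"
    if G: "\<And>s. (G has_real_derivative h s) (at s)" and s: "s \<ge> 0" for G s
  proof
    have "G 0 \<le> G s"
      using s by (rule DERIV_nonneg_imp_nondecreasing) (metis G h_def powr_ge_zero)
    then show "0 \<le> G s - G 0" by simp
    define K where "K s = - c * (1 + s) powr (1 - \<theta>) - G s" for s
    have "K 0 \<le> K s"
    proof (rule DERIV_nonneg_imp_nondecreasing[OF s])
      fix x :: real assume "0 \<le> x" "x \<le> s"
      have "(K has_real_derivative c * (\<theta> - 1) * (1 + x) powr (- \<theta>) - h x) (at x)"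
        unfolding K_def[abs_def] using \<open>0 \<le> x\<close> DERIV_add[OF DERIV_const DERIV_ident, of 1 x]
        using DERIV_diff[OF DERIV_cmult[OF DERIV_fun_powr[of "\<lambda>s. 1 + s" 1 x "1 - \<theta>"], of "- c"] G[of x]]
        by (simp add: algebra_simps)
      with hle[OF \<open>0 \<le> x\<close>] show "\<exists>y. (K has_real_derivative y) (at x) \<and> 0 \<le> y" by fastforce
    qed
    then have "G s - G 0 \<le> c - c * (1 + s) powr (1 - \<theta>)" by (simp add: K_def)
    also have "\<dots> \<le> c" using c0 by simp
    finally show "G s - G 0 \<le> c" .
  qed
  show thesis
  proof (rule that[of c "\<lambda>s. F s - F 0"])
    show "((\<lambda>s. F s - F 0) has_real_derivative (1 + s\<^sup>2) powr (- \<theta> / 2)) (at s)" for s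
      using F[of s] by (auto intro!: derivative_eq_intros simp: h_def)
    have F': "((\<lambda>s. - F (- s)) has_real_derivative h s) (at s)" for s
      using DERIV_mirror[of F "h s" s] F[of "- s"]
      by (auto intro!: derivative_eq_intros simp: h_def)
    show "\<bar>F s - F 0\<bar> \<le> c" for s
      using key[OF F, of s] key[OF F', of "- s"] c0 by (cases "s \<ge> 0") auto
  qed (fact c0)
qed

lemma smooth_antiderivative_compose:
  fixes q :: "'a::euclidean_space \<Rightarrow> real"
  assumes H: "\<And>s. (H has_real_derivative (1 + s\<^sup>2) powr a) (at s)" and q: "\<And>k. C_k k q"
  shows "C_k k (\<lambda>x. H (q x))"
proof -
  have "C_k (Suc k) (\<lambda>x. H (q x))"
  proof (rule C_k_SucI)
    have qd: "(q has_derivative frechet_derivative q (at x)) (at x)" for x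
      using q[of "Suc k"] by (intro has_derivative_frechet) simp
    show "((\<lambda>x. H (q x)) has_derivative (\<lambda>h. (1 + (q x)\<^sup>2) powr a * frechet_derivative q (at x) h)) (at x)" for x
      using has_derivative_compose[OF qd, of H "(*) ((1 + (q x)\<^sup>2) powr a)"] H[of "q x"]
      by (simp add: has_field_derivative_def)
    show "C_k k (\<lambda>x. (1 + (q x)\<^sup>2) powr a * frechet_derivative q (at x) i)" if "i \<in> Basis" for i
      using q[of "Suc k"] that by (intro C_k_mult smooth_powr_compose q) auto
  qed
  then show ?thesis by (rule C_k_SucD)
qed

text \<open>
  The weight in the remainder of the flux estimate. It equals \<open>\<eta>\<^sup>2\<^sup>-\<^sup>p \<bar>\<nabla>b\<bar>\<^sup>p\<close> for \<open>\<eta> = b(1 - b)\<close>, and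
  comes from \<open>(\<eta>\<^sup>2)\<^sup>1\<^sup>-\<^sup>p (\<eta>\<bar>\<nabla>b\<bar>)\<^sup>p\<close> in Young's inequality. It vanishes where \<open>b = 1\<close>.
\<close>

definition cutoff_weight :: "real \<Rightarrow> ('a::euclidean_space \<Rightarrow> real) \<Rightarrow> 'a \<Rightarrow> real" where
  "cutoff_weight p b x = (b x * (1 - b x)) powr (2 - p) * norm (grad b x) powr p"

lemma cutoff_weight_continuous:
  assumes p: "1 < p" "p < 2" and b: "test_function b" "\<And>x. 0 \<le> b x" "\<And>x. b x \<le> 1"
  shows "continuous_on UNIV (cutoff_weight p b)"
  unfolding cutoff_weight_def[abs_def]
  using p test_function_continuous_on[OF b(1)] test_function_grad_continuous[OF b(1)] b(2,3)
  by (intro continuous_on_mult continuous_on_powr' continuous_intros) auto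

lemma cutoff_weight_support:
  assumes "test_function b"
  shows "\<exists>R. \<forall>x. R \<le> norm x \<longrightarrow> cutoff_weight p b x = 0"
  using test_function_grad_bounded_support[OF assms] by (force simp: cutoff_weight_def)

text \<open>
  Two relations between the flux integral \<open>I\<close> and the weighted energy \<open>E\<close> are played off against each
  other. Testing with \<open>H(u/k) \<eta>\<^sup>2\<close> bounds \<open>E\<close> by \<open>I\<close>, and the weighted Young inequality bounds \<open>I\<close> by
  \<open>\<gamma> E\<close> and a remainder. The smallness of \<open>\<gamma>\<close> closes the loop.
\<close>

lemma weak_equation_mass_estimate:
  fixes u v :: "'a::euclidean_space \<Rightarrow> real" and G :: "'a \<Rightarrow> 'a"
  assumes p: "1 < p" "p < 2" and u: "integrable lborel u" and wG: "weak_gradient u G"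
    and G[measurable]: "G \<in> borel_measurable borel"
    and Gp: "integrable lborel (\<lambda>x. norm (G x) powr p)"
    and v: "integrable lborel v"
    and eq: "\<And>\<phi>. test_function \<phi> \<Longrightarrow>
        (LINT x|lborel. flux p (G x) \<bullet> grad \<phi> x) = (LINT x|lborel. v x * \<phi> x)"
    and H: "\<And>s. (H has_real_derivative (1 + s\<^sup>2) powr (- 1 / (2 * (p - 1)))) (at s)" "\<And>s. \<bar>H s\<bar> \<le> C"
    and b: "test_function b" "\<And>x. 0 \<le> b x" "\<And>x. b x \<le> 1"
    and k: "k > 0" and \<gamma>: "\<gamma> > 0" "4 * \<gamma> * C \<le> 1"
  defines "w \<equiv> cutoff_weight p b"
  shows "\<bar>LINT x|lborel. v x * (3 * (b x)\<^sup>2 - 2 * b x ^ 3)\<bar>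
    \<le> 12 * (\<gamma> * C * (LINT x|lborel. \<bar>v x\<bar>) + \<gamma> powr (1 - p) * (k powr (p - 2) * (LINT x|lborel. (\<bar>u x\<bar> + k) * w x)))"
proof -
  define h where "h s = (1 + (s / k)\<^sup>2) powr (- 1 / (2 * (p - 1))) / k" for s
  define Hk where "Hk s = H (s / k)" for s
  define \<eta> where "\<eta> x = b x * (1 - b x)" for x
  have pos: "1 + s\<^sup>2 > 0" for s :: real by (simp add: add_pos_nonneg)
  have [measurable]: "u \<in> borel_measurable borel" "v \<in> borel_measurable borel"
    using u v by auto
  note [measurable] = test_function_measurable[OF b(1)] test_function_grad_measurable[OF b(1)]
  have C0: "C \<ge> 0" using H(2)[of 0] by linarith
  have \<eta>01: "0 \<le> \<eta> x" "\<eta> x \<le> 1" for x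
    using b(2,3)[of x] by (auto simp: \<eta>_def intro: mult_le_one)
  have Hk: "(Hk has_real_derivative h s) (at s)" for s
  proof -
    have "((\<lambda>s. H (s / k)) has_real_derivative (1 + (s / k)\<^sup>2) powr (- 1 / (2 * (p - 1))) * (1 / k)) (at s)"
      using k by (intro DERIV_chain2[OF H(1)]) (auto intro!: derivative_eq_intros)
    then show ?thesis by (simp add: Hk_def[abs_def] h_def)
  qed
  have h_pos: "h s > 0" for s using k pos[of "s / k"] by (simp add: h_def)
  have h_bound: "\<bar>h s\<bar> \<le> 1 / k" for s
  proof -
    have "(1 + (s / k)\<^sup>2) powr (- 1 / (2 * (p - 1))) \<le> (1 + (s / k)\<^sup>2) powr 0"
      using p by (intro powr_mono) auto
    also have "\<dots> = 1" using pos[of "s / k"] by simp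
    finally show ?thesis using k h_pos[of s] by (simp add: h_def divide_right_mono)
  qed
  have h_cont: "continuous_on UNIV h"
    unfolding h_def[abs_def] using k pos by (auto intro!: continuous_intros simp: less_imp_neq[OF pos, symmetric])
  have [measurable]: "h \<in> borel_measurable borel" by (rule borel_measurable_continuous_onI) fact
  have smooth: "C_k j (\<lambda>x::'a. Hk (q x))" if "\<And>j. C_k j q" for q j
    using smooth_antiderivative_compose[OF H(1), of "\<lambda>x. inverse k * q x"] C_k_cmult[OF that]
    by (simp add: Hk_def divide_inverse mult.commute)
  have Hk_bound: "\<bar>Hk s\<bar> \<le> C" for s using H(2) by (simp add: Hk_def)
  have [measurable]: "Hk \<in> borel_measurable borel"
    using Hk by (intro borel_measurable_continuous_onI continuous_at_imp_continuous_on) (meson DERIV_isCont)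
  note bd = test_function_grad[OF b(1)]
  have bC: "C_k j b" for j using b(1) by (rule test_function_C_k)
  have t\<eta>: "test_function \<eta>"
    unfolding \<eta>_def[abs_def] by (intro test_function_mult b(1) C_k_diff C_k_const bC)
  have t\<eta>2: "test_function (\<lambda>x. (\<eta> x)\<^sup>2)"
    unfolding power2_eq_square by (intro test_function_mult t\<eta> test_function_C_k[OF t\<eta>])
  have t\<phi>: "test_function (\<lambda>x. 3 * (b x)\<^sup>2 - 2 * b x ^ 3)"
  proof -
    have "test_function (\<lambda>x. b x * (3 * b x - 2 * (b x)\<^sup>2))"
      by (intro test_function_mult b(1) C_k_diff C_k_cmult C_k_power bC)
    then show ?thesis by (simp add: power2_eq_square power3_eq_cube algebra_simps)
  qed
  have g\<phi>: "grad (\<lambda>x. 3 * (b x)\<^sup>2 - 2 * b x ^ 3) x = (6 * \<eta> x) *\<^sub>R grad b x" for x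
    by (rule grad_eqI) (auto intro!: derivative_eq_intros bd simp: fun_eq_iff \<eta>_def power2_eq_square algebra_simps)
  have g\<eta>2: "grad (\<lambda>x. (\<eta> x)\<^sup>2) x = (2 * \<eta> x * (1 - 2 * b x)) *\<^sub>R grad b x" for x
    unfolding \<eta>_def
    by (rule grad_eqI) (auto intro!: derivative_eq_intros bd simp: fun_eq_iff power2_eq_square algebra_simps)
  obtain R where R: "\<And>x. norm x \<ge> R \<Longrightarrow> grad b x = 0" using test_function_grad_bounded_support[OF b(1)] by auto
  define I where "I = (LINT x|lborel. norm (G x) powr (p - 1) * norm (\<eta> x *\<^sub>R grad b x))"
  define V where "V = (LINT x|lborel. \<bar>v x\<bar>)"
  define E where "E = (LINT x|lborel. norm (G x) powr p * (h (u x) * (\<eta> x)\<^sup>2))"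
  define W where "W = \<gamma> powr (1 - p) * (k powr (p - 2) * (LINT x|lborel. (\<bar>u x\<bar> + k) * w x))"
  have c\<eta>: "continuous_on UNIV (\<lambda>x. \<eta> x *\<^sub>R grad b x)"
    using test_function_continuous_on[OF t\<eta>] test_function_grad_continuous[OF b(1)] by (intro continuous_intros) auto
  have iI: "integrable lborel (\<lambda>x. norm (G x) powr (p - 1) * norm (\<eta> x *\<^sub>R grad b x))"
    using integrable_flux_inner(1)[OF p(1) G Gp c\<eta>, where w="\<lambda>_. 1" and C=1 and R=R] R by simp
  have iE: "integrable lborel (\<lambda>x. norm (G x) powr p * (h (u x) * (\<eta> x)\<^sup>2))"
  proof -
    have "\<bar>h (u x) * (\<eta> x)\<^sup>2\<bar> \<le> 1 / k * 1" for x
      unfolding abs_mult using h_bound \<eta>01[of x] k by (intro mult_mono) (auto simp: power_le_one)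
    then have "integrable lborel (\<lambda>x. (h (u x) * (\<eta> x)\<^sup>2) *\<^sub>R (norm (G x) powr p))"
      using test_function_measurable[OF t\<eta>2] test_function_measurable[OF t\<eta>]
      by (intro integrable_bounded_scaleR[OF Gp]) auto
    then show ?thesis by (simp add: mult.commute)
  qed
  \<comment> \<open>The energy bound: test with \<open>H(u/k) \<eta>\<^sup>2\<close>.\<close>
  have E: "E \<le> C * V + 2 * C * I"
  proof -
    have "E + (LINT x|lborel. Hk (u x) * (flux p (G x) \<bullet> grad (\<lambda>x. (\<eta> x)\<^sup>2) x)) = (LINT x|lborel. v x * (Hk (u x) * (\<eta> x)\<^sup>2))"
      unfolding E_def
      by (rule weak_equation_composite_test[OF p(1) u wG G Gp v eq t\<eta>2 Hk Hk_bound h_cont h_bound smooth])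
    moreover have "(LINT x|lborel. v x * (Hk (u x) * (\<eta> x)\<^sup>2)) \<le> C * V"
    proof -
      have le: "\<bar>Hk (u x) * (\<eta> x)\<^sup>2\<bar> \<le> C * 1" for x
        unfolding abs_mult using Hk_bound \<eta>01[of x] C0 by (intro mult_mono) (auto simp: power_le_one)
      have "integrable lborel (\<lambda>x. (Hk (u x) * (\<eta> x)\<^sup>2) *\<^sub>R v x)"
        using le test_function_measurable[OF t\<eta>2] test_function_measurable[OF t\<eta>]
        by (intro integrable_bounded_scaleR[OF v]) auto
      then have "(LINT x|lborel. v x * (Hk (u x) * (\<eta> x)\<^sup>2)) \<le> (LINT x|lborel. C * \<bar>v x\<bar>)"
      proof (intro integral_mono)
        show "v x * (Hk (u x) * (\<eta> x)\<^sup>2) \<le> C * \<bar>v x\<bar>" for x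
          using mult_left_mono[OF le[of x] abs_ge_zero[of "v x"]] abs_ge_self[of "v x * (Hk (u x) * (\<eta> x)\<^sup>2)"]
          by (simp add: abs_mult mult.commute)
      qed (use v in \<open>auto simp: mult.commute\<close>)
      then show ?thesis by (simp add: V_def)
    qed
    moreover have "- (LINT x|lborel. Hk (u x) * (flux p (G x) \<bullet> grad (\<lambda>x. (\<eta> x)\<^sup>2) x)) \<le> 2 * C * I"
    proof -
      have "norm (LINT x|lborel. Hk (u x) * (flux p (G x) \<bullet> grad (\<lambda>x. (\<eta> x)\<^sup>2) x))
        \<le> (LINT x|lborel. 2 * C * (norm (G x) powr (p - 1) * norm (\<eta> x *\<^sub>R grad b x)))"
      proof (rule order.trans[OF integral_norm_bound integral_mono])
        show "integrable lborel (\<lambda>x. 2 * C * (norm (G x) powr (p - 1) * norm (\<eta> x *\<^sub>R grad b x)))"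
          using iI by (rule integrable_mult_right)
        show "integrable lborel (\<lambda>x. norm (Hk (u x) * (flux p (G x) \<bullet> grad (\<lambda>x. (\<eta> x)\<^sup>2) x)))"
        proof (rule integrable_norm, rule integrable_flux_inner(2)[OF p(1) G Gp test_function_grad_continuous[OF t\<eta>2], where R=R and C=C])
          show "grad (\<lambda>x. (\<eta> x)\<^sup>2) x = 0" if "R \<le> norm x" for x using R[OF that] by (simp add: g\<eta>2)
        qed (use Hk_bound in auto)
        fix x
        have "\<bar>flux p (G x) \<bullet> grad (\<lambda>x. (\<eta> x)\<^sup>2) x\<bar> \<le> norm (flux p (G x)) * norm (grad (\<lambda>x. (\<eta> x)\<^sup>2) x)"
          by (rule Cauchy_Schwarz_ineq2)
        also have "norm (grad (\<lambda>x. (\<eta> x)\<^sup>2) x) \<le> 2 * norm (\<eta> x *\<^sub>R grad b x)"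
        proof -
          define c where "c = 1 - 2 * b x"
          have "\<bar>c\<bar> \<le> 1" using b(2,3)[of x] by (auto simp: c_def)
          then have "\<bar>c\<bar> * (2 * norm (\<eta> x *\<^sub>R grad b x)) \<le> 1 * (2 * norm (\<eta> x *\<^sub>R grad b x))"
            by (rule mult_right_mono) simp
          then show ?thesis unfolding g\<eta>2 c_def[symmetric] by (simp add: abs_mult mult_ac)
        qed
        finally have "\<bar>flux p (G x) \<bullet> grad (\<lambda>x. (\<eta> x)\<^sup>2) x\<bar> \<le> norm (G x) powr (p - 1) * (2 * norm (\<eta> x *\<^sub>R grad b x))"
          by (simp add: norm_flux mult_left_mono)
        from mult_mono[OF Hk_bound this C0 abs_ge_zero, of "u x"]
        show "norm (Hk (u x) * (flux p (G x) \<bullet> grad (\<lambda>x. (\<eta> x)\<^sup>2) x)) \<le> 2 * C * (norm (G x) powr (p - 1) * norm (\<eta> x *\<^sub>R grad b x))"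
          by (simp add: abs_mult mult_ac)
      qed
      also have "\<dots> = 2 * C * I" by (simp add: I_def)
      finally show ?thesis by simp
    qed
    ultimately show ?thesis by linarith
  qed
  have w0: "w x \<ge> 0" for x by (simp add: w_def cutoff_weight_def)
  have iw: "integrable lborel (\<lambda>x. (\<bar>u x\<bar> + k) * w x)"
  proof -
    note cw = cutoff_weight_continuous[OF p b, folded w_def]
    obtain R where w_supp: "\<And>x. R \<le> norm x \<Longrightarrow> w x = 0"
      using cutoff_weight_support[OF b(1), of p] unfolding w_def by auto
    obtain B where B: "\<And>x. norm (w x) \<le> B" using bounded_support_bounded[OF cw w_supp] by metis
    have "integrable lborel (\<lambda>x. w x *\<^sub>R \<bar>u x\<bar>)"
      using u B borel_measurable_continuous_onI[OF cw] by (intro integrable_bounded_scaleR[where B=B]) auto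
    moreover have "integrable lborel w" by (rule integrable_bounded_support[OF cw w_supp])
    ultimately have "integrable lborel (\<lambda>x. w x *\<^sub>R \<bar>u x\<bar> + k * w x)" by simp
    then show ?thesis by (simp add: algebra_simps)
  qed
  \<comment> \<open>The flux bound: apply the weighted Young inequality pointwise, with \<open>s = \<gamma> h(u) \<eta>\<^sup>2\<close>.\<close>
  have I_le: "I \<le> \<gamma> * E + W"
  proof -
    have "I \<le> (LINT x|lborel. \<gamma> * (norm (G x) powr p * (h (u x) * (\<eta> x)\<^sup>2))
        + \<gamma> powr (1 - p) * (k powr (p - 2) * ((\<bar>u x\<bar> + k) * w x)))"
      unfolding I_def
    proof (rule integral_mono[OF iI])
      show "integrable lborel (\<lambda>x. \<gamma> * (norm (G x) powr p * (h (u x) * (\<eta> x)\<^sup>2))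
        + \<gamma> powr (1 - p) * (k powr (p - 2) * ((\<bar>u x\<bar> + k) * w x)))"
        using iE iw by simp
      fix x
      show "norm (G x) powr (p - 1) * norm (\<eta> x *\<^sub>R grad b x) \<le> \<gamma> * (norm (G x) powr p * (h (u x) * (\<eta> x)\<^sup>2))
        + \<gamma> powr (1 - p) * (k powr (p - 2) * ((\<bar>u x\<bar> + k) * w x))"
      proof (cases "\<eta> x = 0")
        case True
        then show ?thesis using w0[of x] k by simp
      next
        case False
        then have \<eta>: "\<eta> x > 0" using \<eta>01[of x] by simp
        have "norm (G x) powr (p - 1) * norm (\<eta> x *\<^sub>R grad b x) \<le> (\<gamma> * (h (u x) * (\<eta> x)\<^sup>2)) * norm (G x) powr p
          + (\<gamma> * (h (u x) * (\<eta> x)\<^sup>2)) powr (1 - p) * norm (\<eta> x *\<^sub>R grad b x) powr p"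
          using p \<gamma> h_pos \<eta> by (intro powr_young_weighted) auto
        also have "(\<gamma> * (h (u x) * (\<eta> x)\<^sup>2)) powr (1 - p) * norm (\<eta> x *\<^sub>R grad b x) powr p
          = \<gamma> powr (1 - p) * (h (u x) powr (1 - p) * w x)"
        proof -
          have "((\<eta> x)\<^sup>2) powr (1 - p) = \<eta> x powr (2 * (1 - p))"
            using \<eta> by (simp add: powr_powr flip: powr_numeral)
          moreover have "\<eta> x powr (2 * (1 - p)) * \<eta> x powr p = \<eta> x powr (2 - p)"
            by (simp flip: powr_add)
          ultimately have "((\<eta> x)\<^sup>2) powr (1 - p) * norm (\<eta> x *\<^sub>R grad b x) powr p = w x"
            using \<eta> by (simp add: w_def cutoff_weight_def powr_mult flip: \<eta>_def mult.assoc)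
          then show ?thesis
            using \<gamma> h_pos[of "u x"] by (simp add: powr_mult less_imp_le mult.assoc)
        qed
        \<comment> \<open>The exponent in \<open>H\<close> makes this power of \<open>h\<close> grow only linearly.\<close>
        also have "h (u x) powr (1 - p) \<le> k powr (p - 2) * (\<bar>u x\<bar> + k)"
        proof -
          have "h (u x) powr (1 - p) = (1 + (u x / k)\<^sup>2) powr (1 / 2) * k powr (p - 1)"
          proof -
            define Q where "Q = 1 + (u x / k)\<^sup>2"
            define a where "a = - 1 / (2 * (p - 1))"
            have a: "a * (1 - p) = 1 / 2" using p by (simp add: a_def field_simps)
            have "h (u x) powr (1 - p) = (Q powr a) powr (1 - p) / k powr (1 - p)"
              unfolding h_def Q_def a_def by (rule powr_divide)
            also have "(Q powr a) powr (1 - p) = Q powr (1 / 2)" by (simp only: powr_powr a)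
            also have "Q powr (1 / 2) / k powr (1 - p) = Q powr (1 / 2) * k powr (p - 1)"
              using powr_minus_divide[of k "1 - p"] by simp
            finally show ?thesis unfolding Q_def .
          qed
          also have "\<dots> \<le> (1 + \<bar>u x\<bar> / k) * k powr (p - 1)"
          proof (rule mult_right_mono)
            have "(1 + (u x / k)\<^sup>2) powr (1 / 2) = sqrt (1 + (u x / k)\<^sup>2)" using pos by (simp add: powr_half_sqrt less_imp_le)
            also have "\<dots> \<le> 1 + \<bar>u x\<bar> / k"
              using k by (intro real_le_lsqrt) (auto simp: power2_eq_square algebra_simps)
            finally show "(1 + (u x / k)\<^sup>2) powr (1 / 2) \<le> 1 + \<bar>u x\<bar> / k" .
          qed simp
          also have "\<dots> = k powr (p - 2) * (\<bar>u x\<bar> + k)"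
            using k powr_mult_base[of k "p - 2"] by (simp add: field_simps)
          finally show ?thesis .
        qed
        finally show ?thesis using w0[of x] by (simp add: mult_ac mult_left_mono mult_right_mono)
      qed
    qed
    also have "\<dots> = \<gamma> * E + W" using iE iw by (simp add: E_def W_def)
    finally show ?thesis .
  qed
  have I0: "I \<ge> 0" by (simp add: I_def)
  \<comment> \<open>By \<open>4\<gamma>C \<le> 1\<close> at most half of \<open>I\<close> reappears on the right, and it is finite.\<close>
  have "I \<le> 2 * (\<gamma> * C * V + W)"
  proof -
    have "\<gamma> * E \<le> \<gamma> * (C * V + 2 * C * I)" using E \<gamma>(1) by (intro mult_left_mono) auto
    also have "\<dots> = \<gamma> * C * V + (4 * \<gamma> * C) * (I / 2)" by (simp add: algebra_simps)
    also have "\<dots> \<le> \<gamma> * C * V + 1 * (I / 2)"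
      using \<gamma>(2) I0 by (intro add_left_mono mult_right_mono) auto
    finally have "\<gamma> * E + W \<le> \<gamma> * C * V + I / 2 + W" by simp
    with I_le have "I \<le> \<gamma> * C * V + I / 2 + W" by (rule order.trans)
    then show ?thesis by (simp add: field_simps)
  qed
  moreover have "\<bar>LINT x|lborel. v x * (3 * (b x)\<^sup>2 - 2 * b x ^ 3)\<bar> \<le> 6 * I"
  proof -
    have "norm (LINT x|lborel. flux p (G x) \<bullet> grad (\<lambda>x. 3 * (b x)\<^sup>2 - 2 * b x ^ 3) x)
      \<le> (LINT x|lborel. 6 * (norm (G x) powr (p - 1) * norm (\<eta> x *\<^sub>R grad b x)))"
    proof (rule order.trans[OF integral_norm_bound integral_mono])
      show "integrable lborel (\<lambda>x. 6 * (norm (G x) powr (p - 1) * norm (\<eta> x *\<^sub>R grad b x)))"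
        using iI by (rule integrable_mult_right)
      show "integrable lborel (\<lambda>x. norm (flux p (G x) \<bullet> grad (\<lambda>x. 3 * (b x)\<^sup>2 - 2 * b x ^ 3) x))"
        using integrable_flux_inner(2)[OF p(1) G Gp test_function_grad_continuous[OF t\<phi>], where R=R and C=1 and w="\<lambda>_. 1"] R
        by (intro integrable_norm) (simp add: g\<phi>)
      fix x
      have "\<bar>flux p (G x) \<bullet> grad (\<lambda>x. 3 * (b x)\<^sup>2 - 2 * b x ^ 3) x\<bar> \<le> norm (flux p (G x)) * norm (grad (\<lambda>x. 3 * (b x)\<^sup>2 - 2 * b x ^ 3) x)"
        by (rule Cauchy_Schwarz_ineq2)
      then show "norm (flux p (G x) \<bullet> grad (\<lambda>x. 3 * (b x)\<^sup>2 - 2 * b x ^ 3) x) \<le> 6 * (norm (G x) powr (p - 1) * norm (\<eta> x *\<^sub>R grad b x))"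
        by (simp add: norm_flux g\<phi> abs_mult mult_ac)
    qed
    then show ?thesis by (simp add: eq[OF t\<phi>] I_def)
  qed
  ultimately show ?thesis unfolding V_def W_def by linarith
qed


section \<open>Conservation of mass\<close>

text \<open>
  The flux estimate for the cutoff functions \<open>b(x/R)\<close> with the scale \<open>k = \<delta>R\<^sup>-\<^sup>N\<close>, which is the
  height of a mass \<open>\<delta>\<close> spread over a ball of radius \<open>R\<close>. At the critical exponent the estimate is
  invariant under this scaling, up to the integral of \<open>\<bar>u\<bar>\<close> against \<open>w(x/R)\<close>, which tends to \<open>0\<close>.
\<close>

lemma neg_p_laplacian_bounded_integral_eq_0:
  fixes u v :: "'a::euclidean_space \<Rightarrow> real"
  assumes N: "DIM('a) \<ge> 2" and p_def: "p = 2 * real DIM('a) / (real DIM('a) + 1)"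
    and uv: "(u, v) \<in> neg_p_laplacian_bounded p"
  shows "(LINT x|lborel. v x) = 0"
proof -
  have p: "1 < p" "p < 2" and Np: "real DIM('a) * (2 - p) = p"
    using N by (auto simp: p_def field_simps)
  obtain G where u: "integrable lborel u" and v: "integrable lborel v" and wG: "weak_gradient u G"
    and G: "G \<in> borel_measurable borel" and Gp: "integrable lborel (\<lambda>x. norm (G x) powr p)"
    and eq: "\<And>\<phi>. test_function \<phi> \<Longrightarrow>
        (LINT x|lborel. flux p (G x) \<bullet> grad \<phi> x) = (LINT x|lborel. v x * \<phi> x)"
    using uv by (auto simp: neg_p_laplacian_bounded_def flux_def)
  have [measurable]: "u \<in> borel_measurable borel" "v \<in> borel_measurable borel"
    using u v by auto
  have "1 / (p - 1) > 1" using p by (simp add: field_simps)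
  moreover have "- (1 / (p - 1)) / 2 = - 1 / (2 * (p - 1))" by simp
  ultimately obtain H C where C: "C > 0"
    and H: "\<And>s. (H has_real_derivative (1 + s\<^sup>2) powr (- 1 / (2 * (p - 1)))) (at s)" "\<And>s. \<bar>H s\<bar> \<le> C"
    using bounded_antiderivative[of "1 / (p - 1)"] by metis
  define b where "b = (bump 1 :: 'a \<Rightarrow> real)"
  have tb: "test_function b" and b01: "\<And>x. 0 \<le> b x" "\<And>x. b x \<le> 1" "b 0 = 1"
    by (auto simp: b_def bump_test_function bump_bounds)
  define w where "w = cutoff_weight p b"
  note cw = cutoff_weight_continuous[OF p tb b01(1,2), folded w_def]
  obtain r where w_supp: "\<And>x. r \<le> norm x \<Longrightarrow> w x = 0"
    using cutoff_weight_support[OF tb, of p] unfolding w_def by auto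
  obtain B where B: "\<And>x. norm (w x) \<le> B" using bounded_support_bounded[OF cw w_supp] by metis
  have [measurable]: "w \<in> borel_measurable borel" by (rule borel_measurable_continuous_onI[OF cw])
  have iw: "integrable lborel w" by (rule integrable_bounded_support[OF cw w_supp])
  define V where "V = (LINT x|lborel. \<bar>v x\<bar>)"
  define \<phi> where "\<phi> x = 3 * (b x)\<^sup>2 - 2 * b x ^ 3" for x
  define R where "R n = real (Suc n)" for n
  have R: "R n > 0" for n by (simp add: R_def)
  have scale0: "(\<lambda>n. x /\<^sub>R R n) \<longlonglongrightarrow> 0" for x :: 'a
    using tendsto_scaleR[OF LIMSEQ_inverse_real_of_nat tendsto_const[of x]] by (simp add: R_def)
  define \<sigma> where "\<sigma> n = (LINT x|lborel. \<bar>u x\<bar> * w (x /\<^sub>R R n))" for n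
  have i\<sigma>: "integrable lborel (\<lambda>x. w (x /\<^sub>R R n) *\<^sub>R \<bar>u x\<bar>)" for n
    using B u by (intro integrable_bounded_scaleR[where B=B]) auto
  have est: "\<bar>LINT x|lborel. v x * \<phi> (x /\<^sub>R R n)\<bar>
      \<le> 12 * (\<gamma> * C * V + \<gamma> powr (1 - p) * (\<delta> powr (p - 2) * (\<sigma> n + \<delta> * (LINT x|lborel. w x))))"
    if \<gamma>: "\<gamma> > 0" "4 * \<gamma> * C \<le> 1" and \<delta>: "\<delta> > 0" for n \<gamma> \<delta>
  proof -
    define k where "k = \<delta> / R n ^ DIM('a)"
    have k: "k > 0" using \<delta> R by (simp add: k_def)
    have tbR: "test_function (\<lambda>x. b (x /\<^sub>R R n))"
      using test_function_affine[OF tb, of "inverse (R n)" 0] R[of n] by simp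
    have gbR: "grad (\<lambda>x. b (x /\<^sub>R R n)) x = grad b (x /\<^sub>R R n) /\<^sub>R R n" for x
      using grad_affine[OF tb, of 0 "inverse (R n)" x] by simp
    have wR: "cutoff_weight p (\<lambda>x. b (x /\<^sub>R R n)) x = R n powr (- p) * w (x /\<^sub>R R n)" for x
      using R[of n] by (simp add: gbR w_def cutoff_weight_def powr_mult inverse_powr powr_minus)
    \<comment> \<open>The factor \<open>R\<^sup>N\<close> from the dilation turns \<open>k\<close> into \<open>\<delta>\<close>.\<close>
    have "(LINT x|lborel. (\<bar>u x\<bar> + k) * (R n powr (- p) * w (x /\<^sub>R R n)))
      = R n powr (- p) * (\<sigma> n + \<delta> * (LINT x|lborel. w x))"
    proof -
      have iwR: "integrable lborel (\<lambda>x. w (x /\<^sub>R R n))"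
      proof (rule integrable_bounded_support)
        show "continuous_on UNIV (\<lambda>x. w (x /\<^sub>R R n))"
          by (rule continuous_on_compose2[OF cw]) (auto intro!: continuous_intros)
        show "w (x /\<^sub>R R n) = 0" if "norm x \<ge> R n * r" for x
          using that R[of n] by (intro w_supp) (simp add: field_simps)
      qed
      have "(LINT x|lborel. (\<bar>u x\<bar> + k) * (R n powr (- p) * w (x /\<^sub>R R n)))
        = (LINT x|lborel. R n powr (- p) * (w (x /\<^sub>R R n) *\<^sub>R \<bar>u x\<bar> + k * w (x /\<^sub>R R n)))"
        by (simp add: algebra_simps)
      also have "\<dots> = R n powr (- p) * (\<sigma> n + k * (LINT x|lborel. w (x /\<^sub>R R n)))"
        using i\<sigma>[of n] iwR by (simp add: \<sigma>_def mult.commute)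
      also have "(LINT x|lborel. w (x /\<^sub>R R n)) = R n ^ DIM('a) * (LINT x|lborel. w x)"
        by (rule integral_lborel_dilate) (use R in auto)
      finally show ?thesis using R[of n] by (simp add: k_def)
    qed
    \<comment> \<open>Here the critical exponent enters: \<open>N(2 - p) = p\<close>.\<close>
    moreover have "k powr (p - 2) * (R n powr (- p) * y) = \<delta> powr (p - 2) * y" for y
    proof -
      have "(R n ^ DIM('a)) powr (p - 2) = (R n powr real DIM('a)) powr (p - 2)"
        using R[of n] by (simp add: powr_realpow)
      also have "\<dots> = R n powr (- p)"
        using Np by (simp add: powr_powr algebra_simps)
      finally have "k powr (p - 2) = \<delta> powr (p - 2) / R n powr (- p)"
        unfolding k_def powr_divide by simp
      then show ?thesis using R[of n] by simp
    qed
    ultimately show ?thesis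
      using weak_equation_mass_estimate[OF p u wG G Gp v eq H tbR b01(1) b01(2) k \<gamma>]
      by (simp only: wR \<phi>_def V_def)
  qed
  have lim\<sigma>: "\<sigma> \<longlonglongrightarrow> 0"
  proof -
    have "\<sigma> \<longlonglongrightarrow> (LINT x::'a|lborel. (0::real))"
      unfolding \<sigma>_def[abs_def]
    proof (rule integral_dominated_convergence[where w="\<lambda>x. \<bar>u x\<bar> * B"])
      have "w 0 = 0" using p by (simp add: w_def cutoff_weight_def b01(3))
      moreover have "(\<lambda>n. w (x /\<^sub>R R n)) \<longlonglongrightarrow> w 0" for x
        by (rule continuous_on_tendsto_compose[OF cw scale0]) auto
      ultimately have "(\<lambda>n. \<bar>u x\<bar> * w (x /\<^sub>R R n)) \<longlonglongrightarrow> 0" for x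
        by (intro tendsto_mult_right_zero) simp
      then show "AE x in lborel. (\<lambda>n. \<bar>u x\<bar> * w (x /\<^sub>R R n)) \<longlonglongrightarrow> 0" by simp
      show "AE x in lborel. norm (\<bar>u x\<bar> * w (x /\<^sub>R R n)) \<le> \<bar>u x\<bar> * B" for n
        using B by (auto simp: abs_mult intro!: mult_left_mono)
    qed (use u in auto)
    then show ?thesis by simp
  qed
  have lim\<phi>: "(\<lambda>n. LINT x|lborel. v x * \<phi> (x /\<^sub>R R n)) \<longlonglongrightarrow> (LINT x|lborel. v x)"
  proof (rule integral_dominated_convergence[where w="\<lambda>x. \<bar>v x\<bar> * 5"])
    have c: "continuous_on UNIV \<phi>"
      unfolding \<phi>_def using test_function_continuous_on[OF tb] by (intro continuous_intros)
    have "(\<lambda>n. \<phi> (x /\<^sub>R R n)) \<longlonglongrightarrow> \<phi> 0" for x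
      by (rule continuous_on_tendsto_compose[OF c scale0]) auto
    moreover have "\<phi> 0 = 1" by (simp add: \<phi>_def b01(3))
    ultimately have "(\<lambda>n. v x * \<phi> (x /\<^sub>R R n)) \<longlonglongrightarrow> v x * 1" for x
      by (intro tendsto_mult_left) simp
    then show "AE x in lborel. (\<lambda>n. v x * \<phi> (x /\<^sub>R R n)) \<longlonglongrightarrow> v x" by simp
    have "\<bar>\<phi> y\<bar> \<le> 5" for y
    proof -
      have "0 \<le> (b y)\<^sup>2" "(b y)\<^sup>2 \<le> 1" "0 \<le> b y ^ 3" "b y ^ 3 \<le> 1"
        using b01(1,2)[of y] by (auto simp: power_le_one)
      then show ?thesis unfolding \<phi>_def by (intro abs_leI) linarith+
    qed
    then show "AE x in lborel. norm (v x * \<phi> (x /\<^sub>R R n)) \<le> \<bar>v x\<bar> * 5" for n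
      by (auto simp: abs_mult intro!: mult_left_mono)
    show "(\<lambda>x. v x * \<phi> (x /\<^sub>R R n)) \<in> borel_measurable lborel" for n
      using borel_measurable_continuous_onI[OF c] by measurable
  qed (use v in auto)
  have le: "\<bar>LINT x|lborel. v x\<bar> \<le> 12 * (\<gamma> * C * V + \<gamma> powr (p - 1) * (LINT x|lborel. w x))"
    if \<gamma>: "\<gamma> > 0" "4 * \<gamma> * C \<le> 1" for \<gamma>
  proof -
    \<comment> \<open>Take \<open>\<delta> = \<gamma>\<^sup>2\<close>, so that \<open>\<gamma>\<^sup>1\<^sup>-\<^sup>p \<delta>\<^sup>p\<^sup>-\<^sup>1 = \<gamma>\<^sup>p\<^sup>-\<^sup>1\<close>, and let \<open>R \<rightarrow> \<infinity>\<close>.\<close>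
    have "\<bar>LINT x|lborel. v x\<bar> \<le> 12 * (\<gamma> * C * V + \<gamma> powr (1 - p) * ((\<gamma>\<^sup>2) powr (p - 2) * (0 + \<gamma>\<^sup>2 * (LINT x|lborel. w x))))"
    proof (rule LIMSEQ_le)
      show "(\<lambda>n. \<bar>LINT x|lborel. v x * \<phi> (x /\<^sub>R R n)\<bar>) \<longlonglongrightarrow> \<bar>LINT x|lborel. v x\<bar>"
        by (rule tendsto_rabs[OF lim\<phi>])
      show "(\<lambda>n. 12 * (\<gamma> * C * V + \<gamma> powr (1 - p) * ((\<gamma>\<^sup>2) powr (p - 2) * (\<sigma> n + \<gamma>\<^sup>2 * (LINT x|lborel. w x)))))
        \<longlonglongrightarrow> 12 * (\<gamma> * C * V + \<gamma> powr (1 - p) * ((\<gamma>\<^sup>2) powr (p - 2) * (0 + \<gamma>\<^sup>2 * (LINT x|lborel. w x))))"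
        by (intro tendsto_intros lim\<sigma>)
      show "\<exists>N. \<forall>n\<ge>N. \<bar>LINT x|lborel. v x * \<phi> (x /\<^sub>R R n)\<bar>
        \<le> 12 * (\<gamma> * C * V + \<gamma> powr (1 - p) * ((\<gamma>\<^sup>2) powr (p - 2) * (\<sigma> n + \<gamma>\<^sup>2 * (LINT x|lborel. w x))))"
        using est[OF \<gamma>, of "\<gamma>\<^sup>2"] \<gamma>(1) by auto
    qed
    also have "\<gamma> powr (1 - p) * ((\<gamma>\<^sup>2) powr (p - 2) * (0 + \<gamma>\<^sup>2 * (LINT x|lborel. w x))) = \<gamma> powr (p - 1) * (LINT x|lborel. w x)"
    proof -
      have "\<gamma>\<^sup>2 = \<gamma> powr 2" using \<gamma>(1) by simp
      then have "\<gamma> powr (1 - p) * ((\<gamma>\<^sup>2) powr (p - 2) * \<gamma>\<^sup>2) = \<gamma> powr ((1 - p) + (2 * (p - 2) + 2))"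
        by (simp only: powr_powr powr_add)
      also have "(1 - p) + (2 * (p - 2) + 2) = p - 1" by simp
      finally have *: "\<gamma> powr (1 - p) * ((\<gamma>\<^sup>2) powr (p - 2) * \<gamma>\<^sup>2) = \<gamma> powr (p - 1)" .
      show ?thesis unfolding *[symmetric] by (simp only: mult.assoc add_0)
    qed
    finally show ?thesis .
  qed
  have "((\<lambda>\<gamma>. 12 * (\<gamma> * C * V + \<gamma> powr (p - 1) * (LINT x|lborel. w x))) \<longlongrightarrow> 12 * (0 * C * V + 0 * (LINT x|lborel. w x))) (at_right 0)"
  proof -
    have "((\<lambda>\<gamma>::real. \<gamma> powr (p - 1)) \<longlongrightarrow> 0 powr (p - 1)) (at_right 0)"
    proof (rule tendsto_powr')
      show "0 \<noteq> (0::real) \<or> 0 < p - 1 \<and> eventually (\<lambda>\<gamma>::real. 0 \<le> \<gamma>) (at_right 0)"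
        using p eventually_at_right_less[of "0::real"] by (auto elim: eventually_mono)
    qed (auto intro!: tendsto_intros)
    then show ?thesis by (intro tendsto_intros) simp_all
  qed
  moreover have "eventually (\<lambda>\<gamma>. \<bar>LINT x|lborel. v x\<bar> \<le> 12 * (\<gamma> * C * V + \<gamma> powr (p - 1) * (LINT x|lborel. w x))) (at_right 0)"
    unfolding eventually_at_right_field
  proof (intro exI[of _ "1 / (4 * C)"] conjI allI impI)
    show "1 / (4 * C) > 0" using C by simp
    fix \<gamma> :: real assume "0 < \<gamma>" "\<gamma> < 1 / (4 * C)"
    then show "\<bar>LINT x|lborel. v x\<bar> \<le> 12 * (\<gamma> * C * V + \<gamma> powr (p - 1) * (LINT x|lborel. w x))"
      using C by (intro le) (auto simp: field_simps)
  qed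
  ultimately have "\<bar>LINT x|lborel. v x\<bar> \<le> 12 * (0 * C * V + 0 * (LINT x|lborel. w x))"
    by (rule tendsto_lowerbound) simp
  then show ?thesis by simp
qed

lemma L1_dist_integral_le:
  assumes "integrable lborel f" "integrable lborel g"
  shows "\<bar>(LINT x|lborel. f x) - (LINT x|lborel. g x)\<bar> \<le> L1_dist f g"
proof -
  have "(LINT x|lborel. f x) - (LINT x|lborel. g x) = (LINT x|lborel. f x - g x)"
    using assms by simp
  then show ?thesis
    using integral_norm_bound[of lborel "\<lambda>x. f x - g x"] by (simp add: L1_dist_def)
qed

lemma neg_p_laplacian_L1_integral_eq_0:
  fixes u v :: "'a::euclidean_space \<Rightarrow> real"
  assumes "DIM('a) \<ge> 2" "p = 2 * real DIM('a) / (real DIM('a) + 1)"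
    and uv: "(u, v) \<in> neg_p_laplacian_L1 p"
  shows "(LINT x|lborel. v x) = 0"
proof -
  obtain U V where v: "integrable lborel v" and UV: "\<And>n::nat. (U n, V n) \<in> neg_p_laplacian_bounded p"
    and lim: "(\<lambda>n. L1_dist (V n) v) \<longlonglongrightarrow> 0"
    using uv by (auto simp: neg_p_laplacian_L1_def)
  have "integrable lborel (V n)" for n using UV[of n] by (simp add: neg_p_laplacian_bounded_def)
  then have "\<bar>LINT x|lborel. v x\<bar> \<le> L1_dist (V n) v" for n
    using L1_dist_integral_le[of "V n" v] v neg_p_laplacian_bounded_integral_eq_0[OF assms(1,2) UV[of n]] by simp
  then have "\<bar>LINT x|lborel. v x\<bar> \<le> 0"
    by (intro LIMSEQ_le_const[OF lim]) auto
  then show ?thesis by simp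
qed

text \<open>
  An operator whose values have integral \<open>0\<close> makes every implicit step preserve the integral, and the
  integral is continuous in \<open>L\<^sup>1\<close>.
\<close>

lemma mild_solution_integral_eq:
  assumes mild: "mild_solution A u0 u" and u0: "integrable lborel u0" and t: "t > 0"
    and A: "\<And>w v. (w, v) \<in> A \<Longrightarrow> integrable lborel w \<and> (LINT x|lborel. v x) = 0"
  shows "(LINT x|lborel. u t x) = (LINT x|lborel. u0 x)"
proof -
  have ut: "integrable lborel (u t)" using mild t by (simp add: mild_solution_def)
  have "\<bar>(LINT x|lborel. u t x) - (LINT x|lborel. u0 x)\<bar> \<le> 0 + e" if e: "e > 0" for e
  proof -
    obtain n \<tau> w where \<tau>: "\<tau> 0 = 0" "t \<le> \<tau> n" "\<And>k. k < n \<Longrightarrow> \<tau> k < \<tau> (Suc k)"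
      and w0: "integrable lborel (w 0)" "L1_dist (w 0) u0 \<le> e / 2"
      and step: "\<And>k. k < n \<Longrightarrow> (w (Suc k), \<lambda>x. (w k x - w (Suc k) x) / (\<tau> (Suc k) - \<tau> k)) \<in> A"
      and uw: "\<And>k t. k < n \<Longrightarrow> t \<in> {\<tau> k<..\<tau> (Suc k)} \<Longrightarrow> L1_dist (u t) (w (Suc k)) \<le> e / 2"
      using mild[unfolded mild_solution_def, THEN conjunct2, THEN conjunct2, THEN conjunct2, rule_format,
          OF t half_gt_zero[OF e]] by blast
    have mass: "integrable lborel (w k) \<and> (LINT x|lborel. w k x) = (LINT x|lborel. w 0 x)" if "k \<le> n" for k
      using that
    proof (induction k)
      case (Suc k)
      then have "k < n" by simp
      then have i: "integrable lborel (w (Suc k))"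
        and 0: "(LINT x|lborel. (w k x - w (Suc k) x) / (\<tau> (Suc k) - \<tau> k)) = 0"
        using A[OF step] by auto
      have "(LINT x|lborel. w k x) = (LINT x|lborel. w (Suc k) x)"
        using 0 i Suc \<tau>(3)[OF \<open>k < n\<close>] by simp
      with i Suc show ?case by simp
    qed (use w0 in simp)
    define j where "j = (LEAST j. t \<le> \<tau> j)"
    have j: "t \<le> \<tau> j" "j \<le> n" unfolding j_def using \<tau>(2) by (auto intro: LeastI Least_le)
    then obtain k where k: "j = Suc k" using \<tau>(1) t by (cases j) auto
    then have "\<tau> k < t" using not_less_Least[of k "\<lambda>j. t \<le> \<tau> j"] by (simp add: j_def[symmetric])
    then have "L1_dist (u t) (w (Suc k)) \<le> e / 2" using j k by (intro uw) auto
    then show ?thesis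
      using L1_dist_integral_le[OF ut, of "w (Suc k)"] L1_dist_integral_le[OF w0(1) u0] w0(2) mass[of "Suc k"] j k
      by auto
  qed
  then have "\<bar>(LINT x|lborel. u t x) - (LINT x|lborel. u0 x)\<bar> \<le> 0" by (rule field_le_epsilon)
  then show ?thesis by simp
qed

theorem theorem7p3:
  fixes u :: "real \<Rightarrow> real ^ 'n \<Rightarrow> real" and u0 :: "real ^ 'n \<Rightarrow> real" and p t :: real
  assumes "CARD('n) \<ge> 2"
    and "p = 2 * real CARD('n) / (real CARD('n) + 1)"
    and "integrable lborel u0"
    and "AE x in lborel. u0 x \<ge> 0"
    and "mild_solution (neg_p_laplacian_L1 p) u0 u"
    and "\<And>s. s > 0 \<Longrightarrow> AE x in lborel. u s x \<ge> 0"
    and "t > 0"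
  shows "(LINT x|lborel. u t x) = (LINT x|lborel. u0 x)"
proof (rule mild_solution_integral_eq[OF assms(5,3,7)])
  fix w v :: "real ^ 'n \<Rightarrow> real" assume "(w, v) \<in> neg_p_laplacian_L1 p"
  then show "integrable lborel w \<and> (LINT x|lborel. v x) = 0"
    using neg_p_laplacian_L1_integral_eq_0[of p w v] assms(1,2)
    by (auto simp: neg_p_laplacian_L1_def)
qed

end
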